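(* Let $S$ and $T$ be chosen independently and uniformly at random from the unit sphere (with respect to the Frobenius norm $|R|_2=\sqrt{\sum_{a,b\in\mathcal{A}^*}R(a,b)^2}$) in the vector space of symmetric scoring functions. Then: (1) almost surely, $\max_{(x,y)\in\mathrm{SET}_{S,T}}x$ has a unique maximiser $(x_0,y_0)$; (2) for every real $k>0$, $\mathbb{P}\left[\kappa(\partial\mathrm{SET}_{S,T},(x_0,y_0))<k\right]\leq \frac{4k}{\pi}$, where $\kappa(\partial\mathrm{SET}_{S,T},(x_0,y_0))$ is the curvature of the boundary of $\mathrm{SET}_{S,T}$ at $(x_0,y_0)$.
   Context: Let $\mathcal{A}$ be a finite alphabet, $G$ a gap symbol, $\mathcal{A}^*=\mathcal{A}\cup\{G\}$. An alignment of two sequences $x_{[1,n]},y_{[1,n]}$ over $\mathcal{A}$ is a pair of increasing sequences $1\le i_1<\dots<i_k\le n$, $1\le j_1<\dots<j_k\le n$; $\Lambda_n$ is the set of all alignments. A symmetric scoring function is $R:\mathcal{A}^*\times\mathcal{A}^*\to\mathbb{R}$ with $R(a,b)=R(b,a)$ and $R(G,G)=0$; these form a real vector space. The score of $\nu=((i_\ell),(j_\ell))$ is $R_\nu(x_{[1,n]},y_{[1,n]})=\sum_{\ell}R(x_{i_\ell},y_{j_\ell})+\sum_{i\notin\{i_\ell\}}R(x_i,G)+\sum_{j\notin\{j_\ell\}}R(G,y_j)$. Let $X_1,X_2,\dots,Y_1,Y_2,\dots$ be i.i.d. random letters of $\mathcal{A}$ with a fixed distribution (independent of $S,T$). Let $L_{n,R}=\max_{\nu\in\Lambda_n}R_\nu(X_{[1,n]},Y_{[1,n]})$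 and $\lambda_R=\lim_n L_{n,R}/n$ (deterministic a.s. limit). Define $\mathrm{SET}_{S,T}=\{(x,y)\in\mathbb{R}^2: ax+by\le\lambda_{aS+bT}\ \forall (a,b)\in\mathbb{R}^2\}$ (the a.s. Hausdorff limit of the closed convex hulls of $\{(S_\nu/n,T_\nu/n):\nu\in\Lambda_n\}$). Curvature: $\kappa(\partial K,p)=\|\ddot c(0)\|_2$ for a unit-speed parametrization $c$ of $\partial K$ with $c(0)=p$; at vertices of $\partial K$ (points where the normal cone has nonempty interior) it is $+\infty$. *)

theory Defs
  imports "HOL-Probability.Probability"
begin

text \<open>Extended alphabet: letters are \<open>Some a\<close>, the gap symbol G is \<open>None\<close>.
  A scoring function is a real vector indexed by pairs of extended letters;
  its Euclidean norm is exactly the Frobenius norm.\<close>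

type_synonym 'a score = "real ^ ('a option \<times> 'a option)"

definition sym_scores :: "'a::finite score set" where
  "sym_scores = {R. (\<forall>u v. R $ (u, v) = R $ (v, u)) \<and> R $ (None, None) = 0}"

definition alignments :: "nat \<Rightarrow> (nat list \<times> nat list) set" where
  "alignments n = {(is, js). length is = length js \<and> sorted_wrt (<) is \<and> sorted_wrt (<) js
      \<and> set is \<subseteq> {1..n} \<and> set js \<subseteq> {1..n}}"

definition align_score :: "nat \<Rightarrow> 'a::finite score \<Rightarrow> (nat \<Rightarrow> 'a) \<Rightarrow> (nat \<Rightarrow> 'a)
    \<Rightarrow> nat list \<times> nat list \<Rightarrow> real" where
  "align_score n R x y \<nu> =
     (\<Sum>(i, j)\<leftarrow>zip (fst \<nu>) (snd \<nu>). R $ (Some (x i), Some (y j)))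
   + (\<Sum>i\<in>{1..n} - set (fst \<nu>). R $ (Some (x i), None))
   + (\<Sum>j\<in>{1..n} - set (snd \<nu>). R $ (None, Some (y j)))"

definition opt_score :: "nat \<Rightarrow> 'a::finite score \<Rightarrow> (nat \<Rightarrow> 'a) \<Rightarrow> (nat \<Rightarrow> 'a) \<Rightarrow> real" where
  "opt_score n R x y = Max (align_score n R x y ` alignments n)"

definition letters_measure :: "'a pmf \<Rightarrow> (nat \<Rightarrow> 'a \<times> 'a) measure" where
  "letters_measure p = PiM UNIV (\<lambda>_. measure_pmf (pair_pmf p p))"

definition lam :: "'a::finite pmf \<Rightarrow> 'a score \<Rightarrow> real" where
  "lam p R = (THE c. AE \<omega> in letters_measure p.
      (\<lambda>n. opt_score n R (\<lambda>i. fst (\<omega> i)) (\<lambda>i. snd (\<omega> i)) / real n) \<longlonglongrightarrow> c)"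

definition SET :: "'a::finite pmf \<Rightarrow> 'a score \<Rightarrow> 'a score \<Rightarrow> (real \<times> real) set" where
  "SET p S T = {(x, y). \<forall>a b. a * x + b * y \<le> lam p (a *\<^sub>R S + b *\<^sub>R T)}"

definition is_x_maximiser :: "(real \<times> real) set \<Rightarrow> real \<times> real \<Rightarrow> bool" where
  "is_x_maximiser K z \<longleftrightarrow> z \<in> K \<and> (\<forall>w\<in>K. fst w \<le> fst z)"

definition normal_cone :: "(real \<times> real) set \<Rightarrow> real \<times> real \<Rightarrow> (real \<times> real) set" where
  "normal_cone K z = {v. \<forall>q\<in>K. v \<bullet> (q - z) \<le> 0}"

definition is_vertex :: "(real \<times> real) set \<Rightarrow> real \<times> real \<Rightarrow> bool" where
  "is_vertex K z \<longleftrightarrow> z \<in> K \<and> interior (normal_cone K z) \<noteq> {}"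

text \<open>Curvature of the boundary of K at z: +infinity at vertices; otherwise the norm
  of the second derivative at 0 of a unit-speed local parametrisation c of the
  boundary with c 0 = z (the relation holds only where such a c exists).\<close>

definition has_curvature :: "(real \<times> real) set \<Rightarrow> real \<times> real \<Rightarrow> ereal \<Rightarrow> bool" where
  "has_curvature K z \<kappa> \<longleftrightarrow>
     (is_vertex K z \<and> \<kappa> = \<infinity>) \<or>
     (\<not> is_vertex K z \<and>
       (\<exists>(c :: real \<Rightarrow> real \<times> real) c' e. 0 < e \<and> c 0 = z
          \<and> (\<forall>t\<in>{-e<..<e}. (c has_vector_derivative c' t) (at t) \<and> norm (c' t) = 1)
          \<and> inj_on c {-e<..<e}
          \<and> c ` {-e<..<e} \<subseteq> frontier K
          \<and> (\<exists>\<delta>>0. frontier K \<inter> ball z \<delta> \<subseteq> c ` {-e<..<e})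
          \<and> (\<exists>a. (c' has_vector_derivative a) (at 0) \<and> \<kappa> = ereal (norm a))))"

definition uniform_on_sphere :: "'a::finite score set \<Rightarrow> 'a score measure \<Rightarrow> bool" where
  "uniform_on_sphere V \<mu> \<longleftrightarrow> prob_space \<mu> \<and> sets \<mu> = sets borel
     \<and> emeasure \<mu> {R\<in>V. norm R = 1} = 1
     \<and> (\<forall>f. orthogonal_transformation f \<and> f ` V = V \<longrightarrow> distr \<mu> borel f = \<mu>)"

end

theory Submission
  imports Defs
begin

text \<open>
  The map \<open>\<lambda>\<close> is sublinear, so \<open>SET\<close> has support function \<open>(a, b) \<mapsto> \<lambda>(aS + bT)\<close>
  and everything is governed by the second differences
  \<open>\<Delta>(b) = \<lambda>(S + bT) + \<lambda>(S - bT) - 2\<lambda>(S)\<close> as \<open>b \<rightarrow> 0\<close>: a kink of the support function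
  in direction \<open>(1, 0)\<close> makes \<open>\<Delta>(b)\<close> of order \<open>b\<close>, and curvature below \<open>k\<close> at the
  maximiser forces \<open>\<Delta>(b) \<ge> b\<^sup>2 / k\<close> for small \<open>b > 0\<close>.

  The law of \<open>S + bT\<close> is invariant under orthogonal maps, so by homogeneity
  \<open>E \<lambda>(S + bT) = m E|S + bT|\<close> with \<open>m = E \<lambda>(S)\<close>. The parallelogram law gives
  \<open>|S + bT| + |S - bT| \<le> 2 + b\<^sup>2\<close>, hence \<open>E \<Delta>(b) \<le> m b\<^sup>2\<close>. Fatou's lemma bounds the mean of
  \<open>liminf \<Delta>(b) / b\<^sup>2\<close> by \<open>m\<close>; finiteness yields uniqueness and Markov's inequality yields the
  bound \<open>k m\<close>. Finally \<open>2m = E (\<lambda>(S) + \<lambda>(-S)) \<le> \<surd>6\<close>, because two alignments differ only through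
  the gains \<open>R(a,b) - R(a,G) - R(G,b)\<close> of matched pairs, and \<open>\<surd>6 / 2 \<le> 4 / \<pi>\<close>.

  That \<open>\<lambda>\<close> exists follows from superadditivity of the mean optimal score together with
  concentration of functions with bounded differences.
\<close>

section \<open>Alignment scores\<close>

text \<open>Extra score from matching two letters instead of setting each against a gap. The
  remaining part of a score, \<open>gap_score\<close>, is the same for all alignments.\<close>

definition pair_gain :: "'a::finite score \<Rightarrow> 'a \<Rightarrow> 'a \<Rightarrow> real" where
  "pair_gain R a b = R $ (Some a, Some b) - R $ (Some a, None) - R $ (None, Some b)"

definition gap_score :: "nat \<Rightarrow> 'a::finite score \<Rightarrow> (nat \<Rightarrow> 'a) \<Rightarrow> (nat \<Rightarrow> 'a) \<Rightarrow> real" where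
  "gap_score n R x y = (\<Sum>i = 1..n. R $ (Some (x i), None)) + (\<Sum>j = 1..n. R $ (None, Some (y j)))"

lemma sum_list_zip_add:
  fixes f g :: "'b \<Rightarrow> real"
  assumes "length is = length js"
  shows "(\<Sum>(i, j)\<leftarrow>zip is js. f i + g j) = (\<Sum>i\<leftarrow>is. f i) + (\<Sum>j\<leftarrow>js. g j)"
  using assms by (induction "is" js rule: list_induct2) auto

lemma alignmentsD:
  assumes "(is, js) \<in> alignments n"
  shows "length is = length js" "sorted_wrt (<) is" "sorted_wrt (<) js"
    "set is \<subseteq> {1..n}" "set js \<subseteq> {1..n}" "distinct is" "distinct js" "length is \<le> n"
proof -
  show *: "length is = length js" "sorted_wrt (<) is" "sorted_wrt (<) js"
    "set is \<subseteq> {1..n}" "set js \<subseteq> {1..n}"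
    using assms by (auto simp: alignments_def)
  show d: "distinct is" "distinct js"
    using * by (simp_all add: strict_sorted_iff)
  have "card (set is) \<le> card {1..n}"
    by (rule card_mono) (use * in auto)
  then show "length is \<le> n" using d by (simp add: distinct_card)
qed

text \<open>Start with every letter facing a gap. Each matched pair then removes two gap terms and
  adds one match term. Distinctness of the index lists ensures that no gap term is removed
  twice.\<close>

lemma align_score_eq:
  assumes "(is, js) \<in> alignments n"
  shows "align_score n R x y (is, js)
    = gap_score n R x y + (\<Sum>(i, j)\<leftarrow>zip is js. pair_gain R (x i) (y j))"
proof -
  note A = alignmentsD[OF assms]
  have gap: "(\<Sum>i\<in>{1..n} - set l. f i) = (\<Sum>i = 1..n. f i) - (\<Sum>i\<leftarrow>l. f i)"
    if "set l \<subseteq> {1..n}" "distinct l" for l and f :: "nat \<Rightarrow> real"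
    using that by (simp add: sum_diff sum_list_distinct_conv_sum_set)
  have split: "(\<Sum>(i, j)\<leftarrow>zip is js. h i j - f i - g j)
      = (\<Sum>(i, j)\<leftarrow>zip is js. h i j) - ((\<Sum>i\<leftarrow>is. f i) + (\<Sum>j\<leftarrow>js. g j))"
    for f g :: "nat \<Rightarrow> real" and h
    using A(1) by (induction "is" js rule: list_induct2) auto
  show ?thesis
    unfolding align_score_def pair_gain_def gap_score_def split
    using A by (simp add: gap del: One_nat_def)
qed

lemma finite_alignments [simp]: "finite (alignments n)"
proof -
  let ?L = "{l :: nat list. set l \<subseteq> {1..n} \<and> length l \<le> n}"
  have "finite ?L" by (rule finite_lists_length_le) simp
  moreover have "alignments n \<subseteq> ?L \<times> ?L"
  proof
    fix \<nu> assume "\<nu> \<in> alignments n"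
    then show "\<nu> \<in> ?L \<times> ?L" using alignmentsD[of "fst \<nu>" "snd \<nu>" n] by (cases \<nu>) auto
  qed
  ultimately show ?thesis by (meson finite_SigmaI finite_subset)
qed

lemma alignments_nonempty [simp]: "alignments n \<noteq> {}"
  by (auto simp: alignments_def intro!: exI[of _ "[]"])

lemma Max_image_diff_le:
  fixes f g :: "'b \<Rightarrow> real"
  assumes "finite A" "A \<noteq> {}" "\<And>a. a \<in> A \<Longrightarrow> \<bar>f a - g a\<bar> \<le> c"
  shows "\<bar>Max (f ` A) - Max (g ` A)\<bar> \<le> c"
proof -
  have le: "Max (u ` A) \<le> Max (v ` A) + c" if "\<And>a. a \<in> A \<Longrightarrow> u a \<le> v a + c" for u v :: "'b \<Rightarrow> real"
    using assms(1,2) that by (subst Max_le_iff) (auto intro!: order_trans[OF that] add_right_mono Max_ge)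
  have "f a \<le> g a + c" "g a \<le> f a + c" if "a \<in> A" for a
    using assms(3)[OF that] by auto
  from le[of f g, OF this(1)] le[of g f, OF this(2)] show ?thesis by auto
qed

lemma align_score_le_opt_score: "\<nu> \<in> alignments n \<Longrightarrow> align_score n R x y \<nu> \<le> opt_score n R x y"
  unfolding opt_score_def by (rule Max_ge) auto

lemma opt_score_attained:
  obtains "is" js where "(is, js) \<in> alignments n" "opt_score n R x y = align_score n R x y (is, js)"
proof -
  have "opt_score n R x y \<in> align_score n R x y ` alignments n"
    unfolding opt_score_def by (rule Max_in) auto
  then show thesis using that by auto
qed

section \<open>Size and sublinearity of the optimal score\<close>

lemma pair_gain_bound: "\<bar>pair_gain R a b\<bar> \<le> 3 * norm R"
  using component_le_norm_cart[of R "(Some a, Some b)"]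
    component_le_norm_cart[of R "(Some a, None)"] component_le_norm_cart[of R "(None, Some b)"]
  unfolding pair_gain_def by linarith

lemma gap_score_bound: "\<bar>gap_score n R x y\<bar> \<le> 2 * real n * norm R"
proof -
  have "\<bar>\<Sum>i = 1..n. R $ h i\<bar> \<le> real n * norm R" for h
    using sum_norm_bound[of "{1..n}" "\<lambda>i. R $ h i" "norm R"] component_le_norm_cart[of R] by simp
  from this[of "\<lambda>i. (Some (x i), None)"] this[of "\<lambda>i. (None, Some (y i))"]
  show ?thesis unfolding gap_score_def by linarith
qed

lemma sum_list_abs_le:
  fixes f :: "'b \<Rightarrow> real"
  assumes "\<And>a. a \<in> set l \<Longrightarrow> \<bar>f a\<bar> \<le> g a"
  shows "\<bar>\<Sum>a\<leftarrow>l. f a\<bar> \<le> (\<Sum>a\<leftarrow>l. g a)"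
  using assms
proof (induction l)
  case (Cons b l)
  then have "\<bar>f b\<bar> \<le> g b" "\<bar>\<Sum>a\<leftarrow>l. f a\<bar> \<le> (\<Sum>a\<leftarrow>l. g a)" by auto
  then show ?case by simp
qed simp

text \<open>The constant is 5 = 2 + 3: there are 2n gap terms, and at most n matched pairs, each
  with a gain of absolute value at most \<open>3 * norm R\<close>.\<close>

lemma align_score_bound:
  assumes "\<nu> \<in> alignments n"
  shows "\<bar>align_score n R x y \<nu>\<bar> \<le> 5 * real n * norm R"
proof -
  obtain "is" js where \<nu>: "\<nu> = (is, js)" by (cases \<nu>)
  note A = alignmentsD[OF assms[unfolded \<nu>]]
  have "\<bar>\<Sum>(i, j)\<leftarrow>zip is js. pair_gain R (x i) (y j)\<bar> \<le> (\<Sum>a\<leftarrow>zip is js. 3 * norm R)"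
    by (rule sum_list_abs_le) (auto simp: pair_gain_bound)
  also have "\<dots> = real (length is) * (3 * norm R)"
    using A(1) by (simp add: sum_list_triv)
  also have "\<dots> \<le> real n * (3 * norm R)"
    using A(8) by (intro mult_right_mono) auto
  finally show ?thesis
    using align_score_eq[OF assms[unfolded \<nu>], of R x y] gap_score_bound[of n R x y] \<nu>
    by (simp add: algebra_simps abs_le_iff)
qed

lemma align_score_add: "align_score n (R + R') x y \<nu> = align_score n R x y \<nu> + align_score n R' x y \<nu>"
  by (simp add: align_score_def sum.distrib sum_list_addf split_def)

lemma align_score_scale: "align_score n (c *\<^sub>R R) x y \<nu> = c * align_score n R x y \<nu>"
  by (simp add: align_score_def sum_distrib_left sum_list_const_mult split_def algebra_simps)

lemma opt_score_bound: "\<bar>opt_score n R x y\<bar> \<le> 5 * real n * norm R"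
  by (metis opt_score_attained align_score_bound)

text \<open>Scores are linear in the scoring function, and an alignment optimal for the sum is a
  competitor in both maxima on the right.\<close>

lemma opt_score_add: "opt_score n (R + R') x y \<le> opt_score n R x y + opt_score n R' x y"
proof -
  obtain "is" js where "(is, js) \<in> alignments n"
    "opt_score n (R + R') x y = align_score n (R + R') x y (is, js)"
    by (rule opt_score_attained)
  then show ?thesis by (simp add: align_score_add add_mono align_score_le_opt_score)
qed

lemma opt_score_scale:
  assumes "c \<ge> 0" shows "opt_score n (c *\<^sub>R R) x y = c * opt_score n R x y"
proof (rule antisym)
  obtain "is" js where "(is, js) \<in> alignments n"
    "opt_score n (c *\<^sub>R R) x y = align_score n (c *\<^sub>R R) x y (is, js)"
    by (rule opt_score_attained)
  then show "opt_score n (c *\<^sub>R R) x y \<le> c * opt_score n R x y"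
    by (simp add: align_score_scale mult_left_mono align_score_le_opt_score assms)
  obtain "is" js where "(is, js) \<in> alignments n" "opt_score n R x y = align_score n R x y (is, js)"
    by (rule opt_score_attained)
  then show "c * opt_score n R x y \<le> opt_score n (c *\<^sub>R R) x y"
    using align_score_le_opt_score[of "(is, js)" n "c *\<^sub>R R" x y] by (simp add: align_score_scale)
qed

text \<open>The difference of two gains is the inner product of \<open>R\<close> with a vector
  having at most six entries, each 1 or -1; coordinates shared by the two gains cancel.
  Cauchy-Schwarz gives the factor \<open>sqrt 6\<close>.\<close>

lemma pair_gain_diff_le:
  "pair_gain R a b - pair_gain R a' b' \<le> sqrt 6 * norm R"
proof -
  let ?d = "\<lambda>a b. axis (Some a, Some b) 1 - axis (Some a, None) 1 - axis (None, Some b) 1 :: 'a score"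
  let ?v = "?d a b - ?d a' b'"
  have "pair_gain R a b - pair_gain R a' b' = R \<bullet> ?v"
    by (simp add: pair_gain_def inner_diff_right inner_axis)
  also have "\<dots> \<le> norm R * norm ?v" by (rule norm_cauchy_schwarz)
  also have "?v \<bullet> ?v \<le> 6"
    by (cases "a = a'"; cases "b = b'")
      (simp_all add: inner_diff_left inner_diff_right inner_add_left inner_add_right inner_axis_axis)
  then have "norm ?v \<le> sqrt 6" by (simp add: norm_eq_sqrt_inner)
  then have "norm R * norm ?v \<le> norm R * sqrt 6" by (intro mult_left_mono) auto
  finally show ?thesis by (simp add: mult.commute)
qed

text \<open>A single gain involves three coordinates, so even \<open>sqrt 3\<close> would do. The
  weaker constant matches \<open>pair_gain_diff_le\<close> and covers the case in
  \<open>opt_score_width\<close> where one extreme is 0.\<close>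

lemma pair_gain_abs_le: "\<bar>pair_gain R a b\<bar> \<le> sqrt 6 * norm R"
proof -
  let ?v = "axis (Some a, Some b) 1 - axis (Some a, None) 1 - axis (None, Some b) 1 :: 'a score"
  have "pair_gain R a b = R \<bullet> ?v"
    by (simp add: pair_gain_def inner_diff_right inner_axis)
  then have "\<bar>pair_gain R a b\<bar> \<le> norm R * norm ?v" by (simp add: Cauchy_Schwarz_ineq2)
  also have "?v \<bullet> ?v \<le> 6"
    by (simp add: inner_diff_left inner_diff_right inner_axis_axis)
  then have "norm ?v \<le> sqrt 6" by (simp add: norm_eq_sqrt_inner)
  then have "norm R * norm ?v \<le> norm R * sqrt 6" by (intro mult_left_mono) auto
  finally show ?thesis by (simp add: mult.commute)
qed

text \<open>The gap scores of \<open>R\<close> and \<open>- R\<close> cancel. What remains is a sum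
  of at most n gains along one alignment minus a sum of at most n gains along another, hence at most
  n times the spread of the gains.\<close>

lemma opt_score_width:
  "opt_score n R x y + opt_score n (- R) x y \<le> real n * (sqrt 6 * norm R)"
proof -
  \<comment> \<open>Including 0 yields \<open>v \<le> 0\<close> and \<open>0 \<le> u\<close>, so the
    number of matched pairs, which may differ between the two alignments, can be replaced by n in
    both estimates.\<close>
  define u where "u = Max (insert 0 (range (\<lambda>(a, b). pair_gain R a b)))"
  define v where "v = Min (insert 0 (range (\<lambda>(a, b). pair_gain R a b)))"
  have g: "v \<le> pair_gain R a b" "pair_gain R a b \<le> u" for a b
    unfolding u_def v_def by (rule Min_le Max_ge; force)+
  have "u \<in> insert 0 (range (\<lambda>(a, b). pair_gain R a b))" "v \<in> insert 0 (range (\<lambda>(a, b). pair_gain R a b))"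
    unfolding u_def v_def by (rule Max_in Min_in; force)+
  then have uv: "u - v \<le> sqrt 6 * norm R"
    using pair_gain_diff_le[of R] pair_gain_abs_le[of R] by (auto simp: abs_le_iff)
  have u0: "u \<ge> 0" and v0: "v \<le> 0" unfolding u_def v_def by auto
  obtain is1 js1 where 1: "(is1, js1) \<in> alignments n" "opt_score n R x y = align_score n R x y (is1, js1)"
    by (rule opt_score_attained)
  obtain is2 js2 where 2: "(is2, js2) \<in> alignments n"
    "opt_score n (- R) x y = align_score n (- R) x y (is2, js2)"
    by (rule opt_score_attained)
  have "(\<Sum>(i, j)\<leftarrow>zip is1 js1. pair_gain R (x i) (y j)) \<le> (\<Sum>a\<leftarrow>zip is1 js1. u)"
    by (rule sum_list_mono) (auto simp: g)
  also have "\<dots> = real (length is1) * u"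
    using alignmentsD(1)[OF 1(1)] by (simp add: sum_list_triv)
  also have "\<dots> \<le> real n * u"
    using alignmentsD(8)[OF 1(1)] u0 by (intro mult_right_mono) auto
  finally have s1: "(\<Sum>(i, j)\<leftarrow>zip is1 js1. pair_gain R (x i) (y j)) \<le> real n * u" .
  have "real n * v \<le> real (length is2) * v"
    using alignmentsD(8)[OF 2(1)] v0 by (intro mult_right_mono_neg) auto
  also have "\<dots> = (\<Sum>a\<leftarrow>zip is2 js2. v)"
    using alignmentsD(1)[OF 2(1)] by (simp add: sum_list_triv)
  also have "\<dots> \<le> (\<Sum>(i, j)\<leftarrow>zip is2 js2. pair_gain R (x i) (y j))"
    by (rule sum_list_mono) (auto simp: g)
  finally have s2: "real n * v \<le> (\<Sum>(i, j)\<leftarrow>zip is2 js2. pair_gain R (x i) (y j))" .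
  have "opt_score n (- R) x y = - align_score n R x y (is2, js2)"
    using 2(2) align_score_scale[of n "-1" R] by simp
  then have "opt_score n R x y + opt_score n (- R) x y \<le> real n * u - real n * v"
    using 1 s1 s2 align_score_eq[OF 1(1), of R x y] align_score_eq[OF 2(1), of R x y] by simp
  also have "\<dots> = real n * (u - v)" by (simp add: algebra_simps)
  also have "\<dots> \<le> real n * (sqrt 6 * norm R)" by (intro mult_left_mono uv) auto
  finally show ?thesis .
qed

text \<open>An optimal alignment of the first n letters followed by a shifted optimal alignment of
  the next m letters is one competitor for the whole, and its score is the sum of the two.\<close>

lemma opt_score_superadditive:
  "opt_score n R x y + opt_score m R (\<lambda>i. x (i + n)) (\<lambda>i. y (i + n)) \<le> opt_score (n + m) R x y"
proof -
  let ?x = "\<lambda>i. x (i + n)" and ?y = "\<lambda>i. y (i + n)"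
  obtain is1 js1 where 1: "(is1, js1) \<in> alignments n" "opt_score n R x y = align_score n R x y (is1, js1)"
    by (rule opt_score_attained)
  obtain is2 js2 where 2: "(is2, js2) \<in> alignments m"
    "opt_score m R ?x ?y = align_score m R ?x ?y (is2, js2)"
    by (rule opt_score_attained)
  note A1 = alignmentsD[OF 1(1)] and A2 = alignmentsD[OF 2(1)]
  let ?is = "is1 @ map (\<lambda>i. i + n) is2" and ?js = "js1 @ map (\<lambda>i. i + n) js2"
  have mem: "(?is, ?js) \<in> alignments (n + m)"
  proof -
    have "i < j + n" if "i \<in> set is1 \<and> j \<in> set is2 \<or> i \<in> set js1 \<and> j \<in> set js2" for i j
      using that A1(4,5) A2(4,5) by fastforce
    then show ?thesis
      using A1(1-5) A2(1-5) unfolding alignments_def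
      by (auto simp: sorted_wrt_append sorted_wrt_map subset_iff)
  qed
  have "gap_score (n + m) R x y = gap_score n R x y + gap_score m R ?x ?y"
  proof -
    have "(\<Sum>i = 1..n + m. f i) = (\<Sum>i = 1..n. f i) + (\<Sum>i = 1..m. f (i + n))" for f :: "nat \<Rightarrow> real"
      using sum.ub_add_nat[of 1 n f m] sum.shift_bounds_cl_nat_ivl[of f 1 n m]
      by (simp add: add.commute)
    from this[of "\<lambda>i. R $ (Some (x i), None)"] this[of "\<lambda>i. R $ (None, Some (y i))"]
    show ?thesis unfolding gap_score_def by linarith
  qed
  moreover have "(\<Sum>(i, j)\<leftarrow>zip ?is ?js. pair_gain R (x i) (y j))
    = (\<Sum>(i, j)\<leftarrow>zip is1 js1. pair_gain R (x i) (y j))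
    + (\<Sum>(i, j)\<leftarrow>zip is2 js2. pair_gain R (?x i) (?y j))"
    using A1(1) by (simp add: zip_map_map split_def o_def)
  ultimately have "align_score (n + m) R x y (?is, ?js) = opt_score n R x y + opt_score m R ?x ?y"
    using align_score_eq[OF mem, of R x y] align_score_eq[OF 1(1), of R x y]
      align_score_eq[OF 2(1), of R ?x ?y] 1 2 by simp
  then show ?thesis using align_score_le_opt_score[OF mem, of R x y] by simp
qed

text \<open>Changing position k alters one letter in each sequence. The two gap sums move by at most
  2 each (in units of \<open>norm R\<close>), and at most two matched pairs are affected, each gain
  moving by at most 6. This gives 16 = 4 + 12, uniformly in the alignment and in n.\<close>

lemma opt_score_bounded_difference:
  assumes "\<And>i. i \<noteq> k \<Longrightarrow> x i = x' i \<and> y i = y' i"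
  shows "\<bar>opt_score n R x y - opt_score n R x' y'\<bar> \<le> 16 * norm R"
  unfolding opt_score_def
proof (rule Max_image_diff_le; simp?)
  fix \<nu> assume \<nu>: "\<nu> \<in> alignments n"
  obtain "is" js where eq: "\<nu> = (is, js)" by (cases \<nu>)
  note mem = \<nu>[unfolded eq]
  note A = alignmentsD[OF mem]
  have one: "\<bar>(\<Sum>i = 1..n. R $ h i) - (\<Sum>i = 1..n. R $ h' i)\<bar> \<le> 2 * norm R"
    if "\<And>i. i \<noteq> k \<Longrightarrow> h i = h' i" for h h'
  proof -
    have "(\<Sum>i = 1..n. R $ h i) - (\<Sum>i = 1..n. R $ h' i)
      = (\<Sum>i = 1..n. if i = k then R $ h k - R $ h' k else 0)"
      unfolding sum_subtractf[symmetric] using that by (intro sum.cong) auto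
    also have "\<bar>\<dots>\<bar> \<le> \<bar>R $ h k - R $ h' k\<bar>" by simp
    also have "\<dots> \<le> 2 * norm R"
      using component_le_norm_cart[of R "h k"] component_le_norm_cart[of R "h' k"] by linarith
    finally show ?thesis .
  qed
  have gap: "\<bar>gap_score n R x y - gap_score n R x' y'\<bar> \<le> 4 * norm R"
    using one[of "\<lambda>i. (Some (x i), None)" "\<lambda>i. (Some (x' i), None)"]
      one[of "\<lambda>i. (None, Some (y i))" "\<lambda>i. (None, Some (y' i))"] assms
    unfolding gap_score_def by simp
  \<comment> \<open>The change of a gain is charged to whichever of its two indices equals k. As k
    occurs at most once in each index list, the total charge is at most 6 + 6.\<close>
  let ?i = "\<lambda>i. if i = k then 6 * norm R else 0"
  have cnt: "(\<Sum>i\<leftarrow>l. ?i i) \<le> 6 * norm R" if "distinct l" for l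
    using that by (simp add: sum_list_distinct_conv_sum_set)
  have "\<bar>\<Sum>(i, j)\<leftarrow>zip is js. pair_gain R (x i) (y j) - pair_gain R (x' i) (y' j)\<bar>
    \<le> (\<Sum>(i, j)\<leftarrow>zip is js. ?i i + ?i j)"
  proof (rule sum_list_abs_le, clarify)
    fix i j
    have "\<bar>pair_gain R (x i) (y j) - pair_gain R (x' i) (y' j)\<bar> \<le> 6 * norm R"
      using pair_gain_bound[of R "x i" "y j"] pair_gain_bound[of R "x' i" "y' j"] by linarith
    then show "\<bar>pair_gain R (x i) (y j) - pair_gain R (x' i) (y' j)\<bar> \<le> ?i i + ?i j"
      using assms[of i] assms[of j] by (auto intro: order_trans)
  qed
  also have "\<dots> \<le> 12 * norm R"
    unfolding sum_list_zip_add[OF A(1)] using cnt[OF A(6)] cnt[OF A(7)] by linarith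
  finally have "\<bar>(\<Sum>(i, j)\<leftarrow>zip is js. pair_gain R (x i) (y j))
     - (\<Sum>(i, j)\<leftarrow>zip is js. pair_gain R (x' i) (y' j))\<bar> \<le> 12 * norm R"
    by (simp add: sum_list_subtractf split_def)
  then show "\<bar>align_score n R x y \<nu> - align_score n R x' y' \<nu>\<bar> \<le> 16 * norm R"
    using gap unfolding eq align_score_eq[OF mem] by linarith
qed

lemma opt_score_cong:
  assumes "\<And>i. i \<in> {1..n} \<Longrightarrow> x i = x' i \<and> y i = y' i"
  shows "opt_score n R x y = opt_score n R x' y'"
proof -
  have "align_score n R x y \<nu> = align_score n R x' y' \<nu>" if \<nu>: "\<nu> \<in> alignments n" for \<nu>
  proof -
    obtain "is" js where eq: "\<nu> = (is, js)" by (cases \<nu>)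
    note A = alignmentsD[OF \<nu>[unfolded eq]]
    have "(\<Sum>(i, j)\<leftarrow>zip is js. R $ (Some (x i), Some (y j)))
      = (\<Sum>(i, j)\<leftarrow>zip is js. R $ (Some (x' i), Some (y' j)))"
    proof (intro arg_cong[of _ _ sum_list] map_cong refl, clarify)
      fix i j assume "(i, j) \<in> set (zip is js)"
      then have "i \<in> {1..n}" "j \<in> {1..n}"
        using A(4,5) by (auto dest: set_zip_leftD set_zip_rightD)
      then show "R $ (Some (x i), Some (y j)) = R $ (Some (x' i), Some (y' j))"
        using assms by simp
    qed
    then show ?thesis
      unfolding eq align_score_def using assms by simp
  qed
  then show ?thesis unfolding opt_score_def by simp
qed

section \<open>Concentration and the limiting score\<close>

text \<open>Prepending an independent letter to an i.i.d. sequence gives a sequence with the same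
  law, so Fubini's theorem lets the first coordinate be integrated last.\<close>

lemma (in sequence_space) integral_iterate:
  fixes F :: "(nat \<Rightarrow> 'a) \<Rightarrow> real"
  assumes F [measurable]: "F \<in> borel_measurable S" and bound: "\<And>\<omega>. \<bar>F \<omega>\<bar> \<le> B"
  shows "(\<integral>\<omega>. F \<omega> \<partial>S) = (\<integral>s. (\<integral>\<omega>. F (case_nat s \<omega>) \<partial>S) \<partial>M)"
    "(\<lambda>s. \<integral>\<omega>. F (case_nat s \<omega>) \<partial>S) \<in> borel_measurable M"
proof -
  interpret M: prob_space M by (rule prob_space)
  interpret PP: pair_prob_space M S ..
  have m: "(\<lambda>(s, \<omega>). F (case_nat s \<omega>)) \<in> borel_measurable (M \<Otimes>\<^sub>M S)" by measurable
  have int: "integrable (M \<Otimes>\<^sub>M S) (\<lambda>(s, \<omega>). F (case_nat s \<omega>))"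
    by (rule PP.integrable_const_bound[where B = B]) (use m bound in auto)
  have "(\<integral>\<omega>. F \<omega> \<partial>S) = (\<integral>\<omega>. F \<omega> \<partial>distr (M \<Otimes>\<^sub>M S) S (\<lambda>(s, \<omega>). case_nat s \<omega>))"
    by (simp only: PiM_iter)
  also have "\<dots> = (\<integral>z. (case z of (s, \<omega>) \<Rightarrow> F (case_nat s \<omega>)) \<partial>(M \<Otimes>\<^sub>M S))"
    by (subst integral_distr) (auto simp: split_def)
  also have "\<dots> = (\<integral>s. (\<integral>\<omega>. F (case_nat s \<omega>) \<partial>S) \<partial>M)"
    using PP.integral_fst'[OF int] by simp
  finally show "(\<integral>\<omega>. F \<omega> \<partial>S) = (\<integral>s. (\<integral>\<omega>. F (case_nat s \<omega>) \<partial>S) \<partial>M)" .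
  show "(\<lambda>s. \<integral>\<omega>. F (case_nat s \<omega>) \<partial>S) \<in> borel_measurable M"
    by measurable
qed

text \<open>The exponential moment bound behind McDiarmid's inequality, by induction on the number
  of relevant coordinates. Given the first coordinate \<open>s\<close>, the induction hypothesis
  controls the fluctuation around the conditional mean \<open>G s\<close>; Hoeffding's lemma
  controls the fluctuation of \<open>G\<close> itself.\<close>

lemma (in sequence_space) bounded_difference_mgf:
  fixes F :: "(nat \<Rightarrow> 'a) \<Rightarrow> real"
  assumes "F \<in> borel_measurable S" "\<And>\<omega>. \<bar>F \<omega>\<bar> \<le> B"
    and "\<And>\<omega> \<omega>'. (\<And>i. i < n \<Longrightarrow> \<omega> i = \<omega>' i) \<Longrightarrow> F \<omega> = F \<omega>'"
    and "\<And>\<omega> \<omega>' k. (\<And>i. i \<noteq> k \<Longrightarrow> \<omega> i = \<omega>' i) \<Longrightarrow> \<bar>F \<omega> - F \<omega>'\<bar> \<le> c"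
    and t: "t > 0"
  shows "(\<integral>\<^sup>+\<omega>. exp (t * (F \<omega> - (\<integral>\<omega>. F \<omega> \<partial>S))) \<partial>S) \<le> ennreal (exp (real n * (t\<^sup>2 * c\<^sup>2 / 2)))"
  using assms(1-4)
proof (induction n arbitrary: F)
  case 0
  \<comment> \<open>A function depending on no coordinate is constant, so any argument
    serves.\<close>
  define v where "v = F undefined"
  have "F = (\<lambda>_. v)" unfolding v_def using 0(3) by blast
  then show ?case by (simp add: P.emeasure_space_1 P.prob_space)
next
  case (Suc n)
  interpret M: prob_space M by (rule prob_space)
  interpret PP: pair_prob_space M S ..
  note F [measurable] = Suc.prems(1)
  define G where "G s = (\<integral>\<omega>. F (case_nat s \<omega>) \<partial>S)" for s
  define m where "m = (\<integral>\<omega>. F \<omega> \<partial>S)"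
  have mG: "m = (\<integral>s. G s \<partial>M)" and [measurable]: "G \<in> borel_measurable M"
    using integral_iterate[OF F Suc.prems(2)] unfolding m_def G_def by auto
  have IH: "(\<integral>\<^sup>+\<omega>. exp (t * (F (case_nat s \<omega>) - G s)) \<partial>S) \<le> ennreal (exp (real n * (t\<^sup>2 * c\<^sup>2 / 2)))"
    if s: "s \<in> space M" for s
    unfolding G_def
  proof (rule Suc.IH)
    show "(\<lambda>\<omega>. F (case_nat s \<omega>)) \<in> borel_measurable S" using s by measurable
    show "\<bar>F (case_nat s \<omega>)\<bar> \<le> B" for \<omega> by (rule Suc.prems)
    show "F (case_nat s \<omega>) = F (case_nat s \<omega>')" if "\<And>i. i < n \<Longrightarrow> \<omega> i = \<omega>' i" for \<omega> \<omega>'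
      using that by (intro Suc.prems) (auto split: nat.split)
    show "\<bar>F (case_nat s \<omega>) - F (case_nat s \<omega>')\<bar> \<le> c" if "\<And>i. i \<noteq> k \<Longrightarrow> \<omega> i = \<omega>' i" for \<omega> \<omega>' k
      using that by (intro Suc.prems(4)[of "Suc k"]) (auto split: nat.split)
  qed
  have Gdiff: "\<bar>G s - G s'\<bar> \<le> c" if "s \<in> space M" "s' \<in> space M" for s s'
  proof -
    have int: "integrable S (\<lambda>\<omega>. F (case_nat r \<omega>))" if "r \<in> space M" for r
      by (rule P.integrable_const_bound[where B = B]) (use that Suc.prems(2) in auto)
    have "\<bar>G s - G s'\<bar> = \<bar>\<integral>\<omega>. F (case_nat s \<omega>) - F (case_nat s' \<omega>) \<partial>S\<bar>"
      unfolding G_def using that int by simp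
    also have "\<dots> \<le> (\<integral>\<omega>. \<bar>F (case_nat s \<omega>) - F (case_nat s' \<omega>)\<bar> \<partial>S)" by (rule integral_abs_bound)
    also have "\<dots> \<le> (\<integral>\<omega>. c \<partial>S)"
      using that int by (intro integral_mono integrable_abs Bochner_Integration.integrable_diff)
        (auto intro!: Suc.prems(4)[of 0] split: nat.split)
    finally show ?thesis by (simp add: P.prob_space)
  qed
  obtain s0 where s0: "s0 \<in> space M" using M.not_empty by blast
  \<comment> \<open>Values of \<open>G\<close> lie within c of its value at an arbitrary point, so
    in an interval of length 2c. Hoeffding's exponent \<open>t\<^sup>2 * (2 * c)\<^sup>2 / 8\<close>
    is the \<open>t\<^sup>2 * c\<^sup>2 / 2\<close> spent on each coordinate.\<close>
  interpret iv: interval_bounded_random_variable M G "G s0 - c" "G s0 + c"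
  proof unfold_locales
    show "AE s in M. G s \<in> {G s0 - c..G s0 + c}"
    proof (rule AE_I2)
      fix s assume "s \<in> space M"
      from Gdiff[OF this s0] show "G s \<in> {G s0 - c..G s0 + c}" by auto
    qed
  qed measurable
  have "(\<integral>\<^sup>+\<omega>. exp (t * (F \<omega> - m)) \<partial>S)
      = (\<integral>\<^sup>+\<omega>. exp (t * (F \<omega> - m)) \<partial>distr (M \<Otimes>\<^sub>M S) S (\<lambda>(s, \<omega>). case_nat s \<omega>))"
    by (simp only: PiM_iter)
  also have "\<dots> = (\<integral>\<^sup>+z. exp (t * (F (case z of (s, \<omega>) \<Rightarrow> case_nat s \<omega>) - m)) \<partial>(M \<Otimes>\<^sub>M S))"
    by (rule nn_integral_distr) measurable
  also have "\<dots> = (\<integral>\<^sup>+s. (\<integral>\<^sup>+\<omega>. exp (t * (F (case_nat s \<omega>) - m)) \<partial>S) \<partial>M)"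
    by (subst P.nn_integral_fst[symmetric]) (auto simp: split_def)
  also have "\<dots> \<le> (\<integral>\<^sup>+s. ennreal (exp (t * (G s - m))) * ennreal (exp (real n * (t\<^sup>2 * c\<^sup>2 / 2))) \<partial>M)"
  proof (rule nn_integral_mono)
    fix s assume s: "s \<in> space M"
    have "(\<integral>\<^sup>+\<omega>. exp (t * (F (case_nat s \<omega>) - m)) \<partial>S)
        = (\<integral>\<^sup>+\<omega>. ennreal (exp (t * (G s - m))) * ennreal (exp (t * (F (case_nat s \<omega>) - G s))) \<partial>S)"
      by (intro nn_integral_cong) (simp add: ennreal_mult' [symmetric] exp_add [symmetric] algebra_simps)
    also have "\<dots> = ennreal (exp (t * (G s - m))) * (\<integral>\<^sup>+\<omega>. ennreal (exp (t * (F (case_nat s \<omega>) - G s))) \<partial>S)"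
      using s by (intro nn_integral_cmult) measurable
    also have "\<dots> \<le> ennreal (exp (t * (G s - m))) * ennreal (exp (real n * (t\<^sup>2 * c\<^sup>2 / 2)))"
      by (intro mult_left_mono IH s) auto
    finally show "(\<integral>\<^sup>+\<omega>. exp (t * (F (case_nat s \<omega>) - m)) \<partial>S)
      \<le> ennreal (exp (t * (G s - m))) * ennreal (exp (real n * (t\<^sup>2 * c\<^sup>2 / 2)))" .
  qed
  also have "\<dots> = (\<integral>\<^sup>+s. ennreal (exp (t * (G s - m))) \<partial>M) * ennreal (exp (real n * (t\<^sup>2 * c\<^sup>2 / 2)))"
    by (rule nn_integral_multc) measurable
  also have "\<dots> \<le> ennreal (exp (t\<^sup>2 * ((G s0 + c) - (G s0 - c))\<^sup>2 / 8)) * ennreal (exp (real n * (t\<^sup>2 * c\<^sup>2 / 2)))"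
    unfolding mG by (intro mult_right_mono iv.Hoeffdings_lemma_nn_integral t) auto
  also have "\<dots> = ennreal (exp (real (Suc n) * (t\<^sup>2 * c\<^sup>2 / 2)))"
    by (simp add: ennreal_mult' [symmetric] exp_add [symmetric] algebra_simps power2_eq_square)
  finally show ?case unfolding m_def .
qed

text \<open>Normalised exponentials with summable means have an almost surely finite sum, so they
  are eventually below 1; taking logarithms gives the deviation bound. This is the Borel-Cantelli
  argument carried out on expectations instead of events.\<close>

lemma (in sequence_space) bounded_difference_upper_deviation:
  fixes F :: "nat \<Rightarrow> (nat \<Rightarrow> 'a) \<Rightarrow> real"
  assumes meas [measurable]: "\<And>n. F n \<in> borel_measurable S" and bound: "\<And>n \<omega>. \<bar>F n \<omega>\<bar> \<le> B n"
    and dep: "\<And>n \<omega> \<omega>'. (\<And>i. i < Suc n \<Longrightarrow> \<omega> i = \<omega>' i) \<Longrightarrow> F n \<omega> = F n \<omega>'"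
    and diff: "\<And>n \<omega> \<omega>' k. (\<And>i. i \<noteq> k \<Longrightarrow> \<omega> i = \<omega>' i) \<Longrightarrow> \<bar>F n \<omega> - F n \<omega>'\<bar> \<le> c"
    and t: "t > 0"
  shows "AE \<omega> in S. eventually (\<lambda>n. (F n \<omega> - (\<integral>\<omega>. F n \<omega> \<partial>S)) / real n \<le> t * (c\<^sup>2 + 1)) sequentially"
proof -
  define E where "E n = (\<integral>\<omega>. F n \<omega> \<partial>S)" for n
  \<comment> \<open>The first part of the exponent compensates the moment bound for
    \<open>Suc n\<close> coordinates; the surplus \<open>real n * t\<^sup>2\<close> makes the means
    geometrically small.\<close>
  define Z where "Z n \<omega> = exp (t * (F n \<omega> - E n)) * exp (- (real (Suc n) * (t\<^sup>2 * c\<^sup>2 / 2) + real n * t\<^sup>2))"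
    for n \<omega>
  have "(\<integral>\<^sup>+\<omega>. Z n \<omega> \<partial>S) \<le> ennreal (exp (- t\<^sup>2) ^ n)" for n
  proof -
    have "(\<integral>\<^sup>+\<omega>. Z n \<omega> \<partial>S) = (\<integral>\<^sup>+\<omega>. exp (t * (F n \<omega> - E n)) \<partial>S)
        * ennreal (exp (- (real (Suc n) * (t\<^sup>2 * c\<^sup>2 / 2) + real n * t\<^sup>2)))"
      unfolding Z_def by (subst nn_integral_multc[symmetric]) (auto simp: ennreal_mult')
    also have "\<dots> \<le> ennreal (exp (real (Suc n) * (t\<^sup>2 * c\<^sup>2 / 2)))
        * ennreal (exp (- (real (Suc n) * (t\<^sup>2 * c\<^sup>2 / 2) + real n * t\<^sup>2)))"
      unfolding E_def by (intro mult_right_mono bounded_difference_mgf[OF meas bound dep diff t]) auto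
    also have "\<dots> = ennreal (exp (- t\<^sup>2) ^ n)"
      by (simp add: ennreal_mult' [symmetric] exp_add [symmetric] exp_of_nat_mult [symmetric])
    finally show ?thesis .
  qed
  then have "(\<Sum>n. \<integral>\<^sup>+\<omega>. Z n \<omega> \<partial>S) \<le> (\<Sum>n. ennreal (exp (- t\<^sup>2) ^ n))"
    by (intro suminf_le) auto
  also have "\<dots> < \<infinity>"
    using t by (subst suminf_ennreal2) (auto intro!: summable_geometric)
  finally have "(\<integral>\<^sup>+\<omega>. (\<Sum>n. ennreal (Z n \<omega>)) \<partial>S) \<noteq> \<infinity>"
    by (subst nn_integral_suminf) (auto simp: Z_def)
  then have "AE \<omega> in S. (\<Sum>n. ennreal (Z n \<omega>)) \<noteq> \<infinity>"
    by (intro nn_integral_PInf_AE) (auto simp: Z_def)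
  then show ?thesis
  proof eventually_elim
    case (elim \<omega>)
    then have "summable (\<lambda>n. Z n \<omega>)"
      by (intro summable_suminf_not_top) (auto simp: Z_def)
    then have "(\<lambda>n. Z n \<omega>) \<longlonglongrightarrow> 0" by (rule summable_LIMSEQ_zero)
    then have "eventually (\<lambda>n. Z n \<omega> < 1) sequentially" by (rule order_tendstoD) simp
    then show ?case using eventually_ge_at_top[of 1]
    proof eventually_elim
      case (elim n)
      from elim(1) have "t * (F n \<omega> - E n) \<le> real (Suc n) * (t\<^sup>2 * c\<^sup>2 / 2) + real n * t\<^sup>2"
        by (simp add: Z_def exp_add [symmetric] exp_diff [symmetric] flip: exp_minus)
      \<comment> \<open>For n at least 1, \<open>Suc n\<close> is at most 2n; this absorbs the extra
        coordinate at index 0.\<close>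
      also have "\<dots> \<le> (2 * real n) * (t\<^sup>2 * c\<^sup>2 / 2) + real n * t\<^sup>2"
        using elim(2) by (intro add_right_mono mult_right_mono) auto
      also have "\<dots> = t * (real n * (t * (c\<^sup>2 + 1)))" by (simp add: algebra_simps power2_eq_square)
      finally have "F n \<omega> - E n \<le> real n * (t * (c\<^sup>2 + 1))" using t by simp
      then show ?case using elim(2) unfolding E_def by (simp add: divide_le_eq mult.commute)
    qed
  qed
qed

text \<open>The upper deviation bound is applied to F and to -F with t = 1/(j+1). Only countably
  many exceptional null sets arise, and the bounds tend to 0 with j.\<close>

lemma (in sequence_space) bounded_difference_strong_law:
  fixes F :: "nat \<Rightarrow> (nat \<Rightarrow> 'a) \<Rightarrow> real"
  assumes meas [measurable]: "\<And>n. F n \<in> borel_measurable S" and bound: "\<And>n \<omega>. \<bar>F n \<omega>\<bar> \<le> B n"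
    and dep: "\<And>n \<omega> \<omega>'. (\<And>i. i < Suc n \<Longrightarrow> \<omega> i = \<omega>' i) \<Longrightarrow> F n \<omega> = F n \<omega>'"
    and diff: "\<And>n \<omega> \<omega>' k. (\<And>i. i \<noteq> k \<Longrightarrow> \<omega> i = \<omega>' i) \<Longrightarrow> \<bar>F n \<omega> - F n \<omega>'\<bar> \<le> c"
  shows "AE \<omega> in S. (\<lambda>n. (F n \<omega> - (\<integral>\<omega>. F n \<omega> \<partial>S)) / real n) \<longlonglongrightarrow> 0"
proof -
  define E where "E n = (\<integral>\<omega>. F n \<omega> \<partial>S)" for n
  define d where "d = c\<^sup>2 + 1"
  have d: "d > 0" unfolding d_def by (simp add: add_nonneg_pos)
  have "AE \<omega> in S. \<forall>j. eventually (\<lambda>n. (F n \<omega> - E n) / real n \<le> inverse (real (Suc j)) * d) sequentially"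
    unfolding AE_all_countable E_def d_def
    by (intro allI bounded_difference_upper_deviation[OF meas bound dep diff]) auto
  moreover have "AE \<omega> in S. \<forall>j. eventually (\<lambda>n. (- F n \<omega> - (\<integral>\<omega>. - F n \<omega> \<partial>S)) / real n
      \<le> inverse (real (Suc j)) * d) sequentially"
    unfolding AE_all_countable d_def
  proof (intro allI bounded_difference_upper_deviation[where B = B])
    show "\<bar>- F n \<omega>\<bar> \<le> B n" for n \<omega> using bound by simp
    show "\<bar>- F n \<omega> - - F n \<omega>'\<bar> \<le> c" if "\<And>i. i \<noteq> k \<Longrightarrow> \<omega> i = \<omega>' i" for n \<omega> \<omega>' k
      using diff[of k \<omega> \<omega>' n] that by (simp add: abs_minus_commute)
    show "- F n \<omega> = - F n \<omega>'" if "\<And>i. i < Suc n \<Longrightarrow> \<omega> i = \<omega>' i" for n \<omega> \<omega>'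
      using dep[of n \<omega> \<omega>'] that by simp
  qed auto
  ultimately show ?thesis
  proof eventually_elim
    case (elim \<omega>)
    show ?case
    proof (rule LIMSEQ_I)
      fix r :: real assume r: "0 < r"
      obtain j where j: "inverse (real (Suc j)) < r / d"
        using reals_Archimedean[of "r / d"] r d by auto
      then have j': "inverse (real (Suc j)) * d < r" using d by (simp add: pos_less_divide_eq)
      have "eventually (\<lambda>n. norm ((F n \<omega> - E n) / real n - 0) < r) sequentially"
        using elim(1)[rule_format, of j] elim(2)[rule_format, of j]
      proof eventually_elim
        case (elim n)
        have "(- F n \<omega> - (\<integral>\<omega>. - F n \<omega> \<partial>S)) / real n = - ((F n \<omega> - E n) / real n)"
          by (simp add: E_def minus_divide_left)
        with elim j' show ?case by (simp add: abs_less_iff)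
      qed
      then show "\<exists>N. \<forall>n\<ge>N. norm ((F n \<omega> - (\<integral>\<omega>. F n \<omega> \<partial>S)) / real n - 0) < r"
        unfolding eventually_sequentially E_def .
    qed
  qed
qed

text \<open>Gluing the first n coordinates of one sequence to an independent second sequence
  preserves the law, and deleting those n coordinates leaves the second sequence.\<close>

lemma (in sequence_space) integral_shift:
  fixes F :: "(nat \<Rightarrow> 'a) \<Rightarrow> real"
  assumes F [measurable]: "F \<in> borel_measurable S" and bound: "\<And>\<omega>. \<bar>F \<omega>\<bar> \<le> B"
  shows "(\<integral>\<omega>. F (\<lambda>i. \<omega> (i + n)) \<partial>S) = (\<integral>\<omega>. F \<omega> \<partial>S)"
proof -
  interpret PP: pair_prob_space S S ..
  have sh [measurable]: "(\<lambda>\<omega>. (\<lambda>i. \<omega> (i + n))) \<in> measurable S S"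
    by (rule measurable_PiM_single') (auto simp: space_PiM)
  have "(\<integral>\<omega>. F (\<lambda>i. \<omega> (i + n)) \<partial>S)
      = (\<integral>\<omega>. F (\<lambda>i. \<omega> (i + n)) \<partial>distr (S \<Otimes>\<^sub>M S) S (\<lambda>(\<omega>, \<omega>'). comb_seq n \<omega> \<omega>'))"
    by (simp only: PiM_comb_seq)
  also have "\<dots> = (\<integral>z. F (\<lambda>i. (case z of (\<omega>, \<omega>') \<Rightarrow> comb_seq n \<omega> \<omega>') (i + n)) \<partial>(S \<Otimes>\<^sub>M S))"
    by (rule integral_distr) measurable
  also have "\<dots> = (\<integral>(\<omega>, \<omega>'). F \<omega>' \<partial>(S \<Otimes>\<^sub>M S))"
    by (simp add: split_def comb_seq_def)
  also have "\<dots> = (\<integral>\<omega>. (\<integral>\<omega>'. F \<omega>' \<partial>S) \<partial>S)"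
  proof -
    have "integrable (S \<Otimes>\<^sub>M S) (\<lambda>(\<omega>, \<omega>'). F \<omega>')"
      by (rule PP.integrable_const_bound[where B = B]) (use bound in auto)
    from PP.integral_fst'[OF this] show ?thesis by simp
  qed
  finally show ?thesis by (simp add: P.prob_space)
qed

text \<open>Fekete's lemma: the limit is the supremum of a(n)/n. Writing n = qm + s with a nearly
  optimal m, q blocks already achieve the rate a(m)/m, and the remainder costs a bounded
  amount.\<close>

lemma superadditive_limit:
  fixes a :: "nat \<Rightarrow> real"
  assumes super: "\<And>m n. a m + a n \<le> a (m + n)" and bound: "\<And>n. \<bar>a n\<bar> \<le> C * real n"
  shows "\<exists>c. (\<lambda>n. a n / real n) \<longlonglongrightarrow> c"
proof -
  define c where "c = (SUP n\<in>{1..}. a n / real n)"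
  have C: "C \<ge> 0" using order_trans[OF abs_ge_zero bound[of 1]] by simp
  have upper: "a n / real n \<le> C" if "n \<ge> 1" for n
    using bound[of n] that by (simp add: divide_le_eq)
  have bdd: "bdd_above ((\<lambda>n. a n / real n) ` {1..})"
    by (rule bdd_aboveI2[of _ _ C]) (use upper in auto)
  have le_c: "a n / real n \<le> c" if "n \<ge> 1" for n
    unfolding c_def by (rule cSUP_upper[OF _ bdd]) (use that in auto)
  have mult: "real q * a m \<le> a (q * m)" for q m
  proof (induction q)
    case 0 then show ?case using bound[of 0] by simp
  next
    case (Suc q) then show ?case using super[of m "q * m"] by (simp add: algebra_simps)
  qed
  have "(\<lambda>n. a n / real n) \<longlonglongrightarrow> c"
  proof (rule LIMSEQ_I)
    fix r :: real assume r: "0 < r"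
    have "c - r / 2 < (SUP n\<in>{1..}. a n / real n)" unfolding c_def[symmetric] using r by simp
    then obtain m where m: "m \<ge> 1" "c - r / 2 < a m / real m"
      using less_cSUP_iff[OF _ bdd] by auto
    \<comment> \<open>The remainder loses at most \<open>2 * C * m\<close>: once because the rate is
      missed on s letters, once because \<open>a s\<close> may be negative. Beyond N this is less
      than n r/2.\<close>
    obtain N where N: "2 * C * real m / (r / 2) < real N" using reals_Archimedean2 by blast
    show "\<exists>N. \<forall>n\<ge>N. norm (a n / real n - c) < r"
    proof (intro exI[of _ "max 1 N"] allI impI)
      fix n assume n: "n \<ge> max 1 N"
      define q s where "q = n div m" and "s = n mod m"
      have nqs: "n = q * m + s" and s: "s \<le> m" using m by (auto simp: q_def s_def less_imp_le)
      have "real q * a m = real (q * m) * (a m / real m)" using m by simp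
      also have "\<dots> = real n * (a m / real m) - real s * (a m / real m)"
        unfolding nqs by (simp add: algebra_simps)
      finally have q: "real q * a m = real n * (a m / real m) - real s * (a m / real m)" .
      have "real s * (a m / real m) \<le> real s * C" by (intro mult_left_mono upper m) auto
      also have "\<dots> \<le> real m * C" using s C by (intro mult_right_mono) auto
      finally have 1: "real s * (a m / real m) \<le> C * real m" by (simp add: mult.commute)
      have "- (C * real s) \<le> a s" using bound[of s] by linarith
      moreover have "C * real s \<le> C * real m" using s C by (intro mult_left_mono) auto
      ultimately have "real n * (a m / real m) - 2 * C * real m \<le> a n"
        using super[of "q * m" s, folded nqs] mult[of q m] 1 q by linarith
      moreover have "2 * C * real m < real n * (r / 2)"
      proof -
        have "2 * C * real m / (r / 2) < real n" using N n by linarith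
        then show ?thesis using r by (simp add: divide_less_eq)
      qed
      moreover have "real n * (c - r / 2) \<le> real n * (a m / real m)"
        using m by (intro mult_left_mono) auto
      ultimately have "real n * (c - r) < a n" by (simp add: algebra_simps)
      then have "c - r < a n / real n" using n by (simp add: less_divide_eq mult.commute)
      then show "norm (a n / real n - c) < r" using le_c[of n] n r by (simp add: abs_less_iff)
    qed
  qed
  then show ?thesis by blast
qed

section \<open>Almost sure convergence of the normalised optimal score\<close>

abbreviation opt_score_seq :: "nat \<Rightarrow> 'a::finite score \<Rightarrow> (nat \<Rightarrow> 'a \<times> 'a) \<Rightarrow> real" where
  "opt_score_seq n R \<omega> \<equiv> opt_score n R (\<lambda>i. fst (\<omega> i)) (\<lambda>i. snd (\<omega> i))"

lemma measurable_opt_score [measurable]: "opt_score_seq n R \<in> borel_measurable (letters_measure p)"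
proof -
  have coord: "(\<lambda>\<omega>. f (\<omega> i)) \<in> borel_measurable (letters_measure p)" for f :: "'a \<times> 'a \<Rightarrow> real" and i
    unfolding letters_measure_def
    by (rule measurable_compose[OF measurable_component_singleton]) auto
  \<comment> \<open>A matched pair depends on two coordinates. Splitting over the finitely many
    values of the first leaves a function of one coordinate.\<close>
  have pair: "(\<lambda>\<omega>. R $ (Some (fst (\<omega> i)), Some (snd (\<omega> j)))) \<in> borel_measurable (letters_measure p)" for i j
  proof (rule measurable_compose_countable'[where g = "\<lambda>\<omega>. \<omega> i" and I = UNIV
        and f = "\<lambda>u \<omega>. R $ (Some (fst u), Some (snd (\<omega> j)))"])
    have "(\<lambda>\<omega>. \<omega> i) \<in> measurable (letters_measure p) (measure_pmf (pair_pmf p p))"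
      unfolding letters_measure_def by (rule measurable_component_singleton) simp
    then show "(\<lambda>\<omega>. \<omega> i) \<in> measurable (letters_measure p) (count_space UNIV)"
      by (simp cong: measurable_cong_sets)
    show "(\<lambda>\<omega>. R $ (Some (fst u), Some (snd (\<omega> j)))) \<in> borel_measurable (letters_measure p)" for u
      by (rule coord)
  qed (auto intro: countable_finite)
  have gap: "(\<lambda>\<omega>. R $ (Some (fst (\<omega> i)), None)) \<in> borel_measurable (letters_measure p)"
    "(\<lambda>\<omega>. R $ (None, Some (snd (\<omega> i)))) \<in> borel_measurable (letters_measure p)" for i
    using coord[of "\<lambda>z. R $ (Some (fst z), None)" i] coord[of "\<lambda>z. R $ (None, Some (snd z))" i] by auto
  have lst: "(\<lambda>\<omega>. \<Sum>(i, j)\<leftarrow>l. R $ (Some (fst (\<omega> i)), Some (snd (\<omega> j)))) \<in> borel_measurable (letters_measure p)" for l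
    by (induction l) (auto simp: split_def intro!: borel_measurable_add pair)
  show ?thesis
    unfolding opt_score_def
    by (rule borel_measurable_Max, simp) (auto simp: align_score_def intro!: borel_measurable_add borel_measurable_sum gap lst)
qed

lemma sequence_space_letters: "sequence_space (measure_pmf (pair_pmf p p))"
  unfolding sequence_space_def by (rule product_prob_spaceI) (rule prob_space_measure_pmf)

lemma prob_space_letters: "prob_space (letters_measure p)"
  unfolding letters_measure_def by (rule prob_space_PiM) (rule prob_space_measure_pmf)

text \<open>Concentration replaces the random score by its mean \<open>E n\<close>. Concatenation of
  alignments together with shift invariance of the letter law makes \<open>E\<close> superadditive,
  so \<open>E n / n\<close> converges.\<close>

lemma opt_score_limit_exists:
  "\<exists>c. AE \<omega> in letters_measure p. (\<lambda>n. opt_score_seq n R \<omega> / real n) \<longlonglongrightarrow> c"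
proof -
  interpret sequence_space "measure_pmf (pair_pmf p p)" by (rule sequence_space_letters)
  note S = letters_measure_def[symmetric, of p]
  define E where "E n = (\<integral>\<omega>. opt_score_seq n R \<omega> \<partial>letters_measure p)" for n
  have bd: "\<bar>opt_score_seq n R \<omega>\<bar> \<le> 5 * real n * norm R" for n \<omega> by (rule opt_score_bound)
  interpret L: prob_space "letters_measure p" by (rule prob_space_letters)
  have int: "integrable (letters_measure p) (opt_score_seq n R)" for n
    by (rule L.integrable_const_bound[where B = "5 * real n * norm R"]) (use bd in auto)
  have conc: "AE \<omega> in letters_measure p. (\<lambda>n. (opt_score_seq n R \<omega> - E n) / real n) \<longlonglongrightarrow> 0"
    unfolding E_def letters_measure_def
  proof (rule bounded_difference_strong_law[OF _ bd])
    show "opt_score_seq n R \<in> borel_measurable S" for n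
      unfolding S by (rule measurable_opt_score)
    \<comment> \<open>Letters are read at indices 1 to n of a sequence starting at 0, so the score
      is determined by the first \<open>Suc n\<close> coordinates.\<close>
    show "opt_score_seq n R \<omega> = opt_score_seq n R \<omega>'" if "\<And>i. i < Suc n \<Longrightarrow> \<omega> i = \<omega>' i" for n \<omega> \<omega>'
      by (rule opt_score_cong) (use that in auto)
    show "\<bar>opt_score_seq n R \<omega> - opt_score_seq n R \<omega>'\<bar> \<le> 16 * norm R"
      if "\<And>i. i \<noteq> k \<Longrightarrow> \<omega> i = \<omega>' i" for n \<omega> \<omega>' k
      by (rule opt_score_bounded_difference[of k]) (use that in auto)
  qed
  have "\<exists>c. (\<lambda>n. E n / real n) \<longlonglongrightarrow> c"
  proof (rule superadditive_limit[where C = "5 * norm R"])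
    fix m n
    have sh: "(\<integral>\<omega>. opt_score_seq n R (\<lambda>i. \<omega> (i + m)) \<partial>letters_measure p) = E n"
      unfolding E_def letters_measure_def
      by (rule integral_shift[OF _ bd]) (unfold S, rule measurable_opt_score)
    have ish: "integrable (letters_measure p) (\<lambda>\<omega>. opt_score_seq n R (\<lambda>i. \<omega> (i + m)))"
    proof (rule L.integrable_const_bound[where B = "5 * real n * norm R"])
      have "(\<lambda>\<omega>. (\<lambda>i. \<omega> (i + m))) \<in> measurable S S"
        by (rule measurable_PiM_single') (auto simp: space_PiM)
      then show "(\<lambda>\<omega>. opt_score_seq n R (\<lambda>i. \<omega> (i + m))) \<in> borel_measurable (letters_measure p)"
        unfolding S by (rule measurable_compose[OF _ measurable_opt_score])
    qed (use bd in auto)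
    have "E m + E n = (\<integral>\<omega>. opt_score_seq m R \<omega> + opt_score_seq n R (\<lambda>i. \<omega> (i + m)) \<partial>letters_measure p)"
      unfolding E_def using int ish sh by (simp add: E_def)
    also have "\<dots> \<le> E (m + n)"
      unfolding E_def using int ish
      by (intro integral_mono Bochner_Integration.integrable_add opt_score_superadditive)
    finally show "E m + E n \<le> E (m + n)" .
    have "\<bar>E n\<bar> \<le> (\<integral>\<omega>. \<bar>opt_score_seq n R \<omega>\<bar> \<partial>letters_measure p)"
      unfolding E_def by (rule integral_abs_bound)
    also have "\<dots> \<le> (\<integral>\<omega>. 5 * real n * norm R \<partial>letters_measure p)"
      using int bd by (intro integral_mono integrable_abs) auto
    finally show "\<bar>E n\<bar> \<le> 5 * norm R * real n" by (simp add: L.prob_space mult_ac)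
  qed
  then obtain c where c: "(\<lambda>n. E n / real n) \<longlonglongrightarrow> c" by blast
  from conc have "AE \<omega> in letters_measure p. (\<lambda>n. opt_score_seq n R \<omega> / real n) \<longlonglongrightarrow> c"
  proof eventually_elim
    case (elim \<omega>)
    from tendsto_add[OF elim c] show ?case by (simp add: diff_divide_distrib)
  qed
  then show ?thesis by blast
qed

text \<open>Justifies the definite description in \<open>lam\<close>: a limit exists, and two almost
  sure limits coincide because a probability space has a point where both hold.\<close>

lemma lam_limit: "AE \<omega> in letters_measure p. (\<lambda>n. opt_score_seq n R \<omega> / real n) \<longlonglongrightarrow> lam p R"
proof -
  interpret L: prob_space "letters_measure p" by (rule prob_space_letters)
  obtain c where c: "AE \<omega> in letters_measure p. (\<lambda>n. opt_score_seq n R \<omega> / real n) \<longlonglongrightarrow> c"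
    using opt_score_limit_exists by blast
  show ?thesis unfolding lam_def
  proof (rule theI, rule c)
    fix d assume "AE \<omega> in letters_measure p. (\<lambda>n. opt_score_seq n R \<omega> / real n) \<longlonglongrightarrow> d"
    with c have "AE \<omega> in letters_measure p. d = c"
      by eventually_elim (rule LIMSEQ_unique)
    then show "d = c" by simp
  qed
qed

section \<open>Sublinearity, growth and width of the limiting score\<close>

lemma lam_add_le: "lam p (R + R') \<le> lam p R + lam p R'"
proof -
  interpret L: prob_space "letters_measure p" by (rule prob_space_letters)
  have "AE \<omega> in letters_measure p. lam p (R + R') \<le> lam p R + lam p R'"
    using lam_limit[where p = p and R = R] lam_limit[where p = p and R = R'] lam_limit[where p = p and R = "R + R'"]
  proof eventually_elim
    case (elim \<omega>)
    show ?case
      by (rule LIMSEQ_le[OF elim(3) tendsto_add[OF elim(1,2)]])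
        (auto simp: add_divide_distrib[symmetric] intro!: divide_right_mono opt_score_add)
  qed
  then show ?thesis by simp
qed

lemma lam_scale:
  assumes "c \<ge> 0" shows "lam p (c *\<^sub>R R) = c * lam p R"
proof -
  interpret L: prob_space "letters_measure p" by (rule prob_space_letters)
  have "AE \<omega> in letters_measure p. lam p (c *\<^sub>R R) = c * lam p R"
    using lam_limit[where p = p and R = R] lam_limit[where p = p and R = "c *\<^sub>R R"]
  proof eventually_elim
    case (elim \<omega>)
    from tendsto_mult_left[OF elim(1), of c] elim(2) show ?case
      by (auto simp: opt_score_scale[OF assms] intro: LIMSEQ_unique)
  qed
  then show ?thesis by simp
qed

lemma lam_le: "lam p R \<le> 5 * norm R"
proof -
  interpret L: prob_space "letters_measure p" by (rule prob_space_letters)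
  have "AE \<omega> in letters_measure p. lam p R \<le> 5 * norm R"
    using lam_limit[where p = p and R = R]
  proof eventually_elim
    case (elim \<omega>)
    have "opt_score_seq n R \<omega> / real n \<le> 5 * norm R" if "n \<ge> 1" for n
      using opt_score_bound[of n R "\<lambda>i. fst (\<omega> i)" "\<lambda>i. snd (\<omega> i)"] that
      by (simp add: divide_le_eq algebra_simps)
    then show ?case by (intro LIMSEQ_le_const2[OF elim]) auto
  qed
  then show ?thesis by simp
qed

lemma lam_width: "lam p R + lam p (- R) \<le> sqrt 6 * norm R"
proof -
  interpret L: prob_space "letters_measure p" by (rule prob_space_letters)
  have "AE \<omega> in letters_measure p. lam p R + lam p (- R) \<le> sqrt 6 * norm R"
    using lam_limit[where p = p and R = R] lam_limit[where p = p and R = "- R"]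
  proof eventually_elim
    case (elim \<omega>)
    have "opt_score_seq n R \<omega> / real n + opt_score_seq n (- R) \<omega> / real n \<le> sqrt 6 * norm R" if "n \<ge> 1" for n
      using opt_score_width[of n R "\<lambda>i. fst (\<omega> i)" "\<lambda>i. snd (\<omega> i)"] that
      by (simp add: add_divide_distrib[symmetric] divide_le_eq algebra_simps)
    then show ?case by (intro LIMSEQ_le_const2[OF tendsto_add[OF elim]]) auto
  qed
  then show ?thesis by simp
qed

section \<open>Orthogonally invariant measures\<close>

text \<open>The reflection in the hyperplane orthogonal to \<open>R - R'\<close> exchanges two
  vectors of equal norm, and it preserves V because the difference lies in V. For
  \<open>R = R'\<close> the formula degenerates to the identity.\<close>

lemma reflection_onto:
  fixes R R' :: "'b::real_inner"
  assumes V: "subspace V" and R: "R \<in> V" "R' \<in> V" "norm R = norm R'"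
  obtains f where "orthogonal_transformation f" "f ` V = V" "f R = R'"
proof -
  define u where "u = R - R'"
  define f where "f x = x - (2 * (x \<bullet> u) / (u \<bullet> u)) *\<^sub>R u" for x
  have lin: "linear f"
    by (rule linearI) (simp_all add: f_def inner_add_left algebra_simps add_divide_distrib)
  have iso: "f v \<bullet> f w = v \<bullet> w" for v w
    by (cases "u = 0") (simp_all add: f_def inner_diff_left inner_diff_right inner_commute)
  have "f (f x) = x" for x
    by (cases "u = 0") (simp_all add: f_def inner_diff_left scaleR_diff_left[symmetric] diff_divide_distrib)
  moreover have sub: "f ` V \<subseteq> V"
    using V R unfolding f_def u_def by (auto intro!: subspace_diff subspace_scale)
  ultimately have "f ` V = V" by (metis image_subset_iff rev_image_eqI subsetI subset_antisym)
  moreover have "f R = R'"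
  proof (cases "u = 0")
    case False
    have "R \<bullet> R = R' \<bullet> R'" using R(3) by (simp add: norm_eq)
    then have "u \<bullet> u = 2 * (R \<bullet> u)"
      by (simp add: u_def inner_diff_left inner_diff_right inner_commute)
    moreover have "u \<bullet> u \<noteq> 0" using False by simp
    ultimately have "2 * (R \<bullet> u) / (u \<bullet> u) = 1" by (metis divide_self)
    then have "f R = R - u" unfolding f_def by (simp only: scaleR_one)
    then show ?thesis by (simp add: u_def)
  qed (auto simp: f_def u_def)
  moreover have "orthogonal_transformation f"
    unfolding orthogonal_transformation_def using lin iso by blast
  ultimately show thesis using that by blast
qed

definition invariant_measure :: "'b::euclidean_space set \<Rightarrow> 'b measure \<Rightarrow> bool" where
  "invariant_measure V \<nu> \<longleftrightarrow> prob_space \<nu> \<and> sets \<nu> = sets borel \<and> (AE R in \<nu>. R \<in> V)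
    \<and> (\<exists>B. AE R in \<nu>. norm R \<le> B)
    \<and> (\<forall>f. orthogonal_transformation f \<and> f ` V = V \<longrightarrow> distr \<nu> borel f = \<nu>)"

text \<open>Mass of the directions close to \<open>u\<close>, weighted by the norm. The weight
  matches functions that are homogeneous of degree one, where
  \<open>f R = norm R * f (sgn R)\<close>.\<close>

definition cap_weight :: "'b::euclidean_space measure \<Rightarrow> real \<Rightarrow> 'b \<Rightarrow> real" where
  "cap_weight \<nu> \<epsilon> u = (\<integral>R. norm R * indicator (ball u \<epsilon>) (sgn R) \<partial>\<nu>)"

lemma sgn_borel_measurable [measurable]: "sgn \<in> borel_measurable (borel :: 'b::euclidean_space measure)"
  unfolding sgn_div_norm by measurable

lemma measurable_indicator_ball [measurable]:
  "(\<lambda>(x, y). indicator (ball x \<epsilon>) y :: real) \<in> borel_measurable (borel \<Otimes>\<^sub>M (borel :: 'b::euclidean_space measure))"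
proof -
  have "(\<lambda>z. if dist (fst z) (snd z) < \<epsilon> then 1 else 0 :: real)
    \<in> borel_measurable (borel \<Otimes>\<^sub>M (borel :: 'b measure))" by measurable
  moreover have "(\<lambda>(x, y). indicator (ball x \<epsilon>) y) = (\<lambda>z :: 'b \<times> 'b. if dist (fst z) (snd z) < \<epsilon> then 1 else 0 :: real)"
    by (auto simp: indicator_def)
  ultimately show ?thesis by simp
qed

text \<open>A reflection carrying u to v carries one cap to the other, keeps norms and preserves the
  measure.\<close>

lemma cap_weight_rotate:
  assumes \<nu>: "invariant_measure V \<nu>" and V: "subspace V"
    and u: "u \<in> V" "norm u = 1" "v \<in> V" "norm v = 1"
  shows "cap_weight \<nu> \<epsilon> u = cap_weight \<nu> \<epsilon> v"
proof -
  obtain f where f: "orthogonal_transformation f" "f ` V = V" "f u = v"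
    using reflection_onto[OF V, of u v] u by auto
  have sets: "sets \<nu> = sets borel" and inv: "distr \<nu> borel f = \<nu>"
    using \<nu> f unfolding invariant_measure_def by auto
  have lin: "linear f" using f(1) orthogonal_transformation_linear by blast
  have fm [measurable]: "f \<in> measurable \<nu> borel"
    using borel_measurable_continuous_onI[OF linear_continuous_on[OF lin[unfolded linear_conv_bounded_linear]]]
    by (simp cong: measurable_cong_sets add: sets)
  have "cap_weight \<nu> \<epsilon> v = (\<integral>R. norm R * indicator (ball v \<epsilon>) (sgn R) \<partial>distr \<nu> borel f)"
    unfolding cap_weight_def inv ..
  also have "\<dots> = (\<integral>R. norm (f R) * indicator (ball v \<epsilon>) (sgn (f R)) \<partial>\<nu>)"
    by (rule integral_distr) measurable
  also have "\<dots> = cap_weight \<nu> \<epsilon> u"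
    unfolding cap_weight_def
  proof (rule Bochner_Integration.integral_cong[OF refl])
    fix R
    have n: "norm (f R) = norm R" using f(1) orthogonal_transformation_norm by blast
    then have "sgn (f R) = f (sgn R)"
      unfolding sgn_div_norm using linear_scale[OF lin] by simp
    moreover have "dist v (f (sgn R)) = dist u (sgn R)"
      using f(1,3) orthogonal_transformation_isometry by metis
    ultimately show "norm (f R) * indicator (ball v \<epsilon>) (sgn (f R)) = norm R * indicator (ball u \<epsilon>) (sgn R)"
      using n by (simp add: indicator_def)
  qed
  finally show ?thesis ..
qed

lemma cap_weight_unit:
  assumes \<mu>: "invariant_measure V \<mu>" "AE R in \<mu>. norm R = 1"
  shows "cap_weight \<mu> \<epsilon> u = measure \<mu> (ball u \<epsilon>)"
proof -
  have sets [measurable_cong]: "sets \<mu> = sets borel" and "prob_space \<mu>"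
    using \<mu> unfolding invariant_measure_def by auto
  interpret prob_space \<mu> by fact
  have "cap_weight \<mu> \<epsilon> u = (\<integral>R. indicator (ball u \<epsilon>) R \<partial>\<mu>)"
    unfolding cap_weight_def using \<mu>(2)
    by (intro integral_cong_AE) (auto simp: sgn_div_norm elim!: eventually_mono)
  then show ?thesis using sets_eq_imp_space_eq[OF sets] by (simp add: sets)
qed

text \<open>If one cap were null, all caps of that radius would be null by rotation. By compactness
  finitely many of them cover the unit sphere of V, on which the measure is concentrated.\<close>

lemma cap_weight_pos:
  assumes \<mu>: "invariant_measure V \<mu>" "AE R in \<mu>. norm R = 1" and V: "subspace V"
    and u: "u \<in> V" "norm u = 1" and \<epsilon>: "\<epsilon> > 0"
  shows "cap_weight \<mu> \<epsilon> u > 0"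
proof (rule ccontr)
  assume "\<not> cap_weight \<mu> \<epsilon> u > 0"
  have sets: "sets \<mu> = sets borel" and "prob_space \<mu>" and AV: "AE R in \<mu>. R \<in> V"
    using \<mu> unfolding invariant_measure_def by auto
  interpret prob_space \<mu> by fact
  have null: "ball v \<epsilon> \<in> null_sets \<mu>" if v: "v \<in> V" "norm v = 1" for v
  proof -
    have "measure \<mu> (ball v \<epsilon>) \<le> 0"
      using \<open>\<not> _\<close> cap_weight_rotate[OF \<mu>(1) V u v, of \<epsilon>] cap_weight_unit[OF \<mu>] by simp
    then have "measure \<mu> (ball v \<epsilon>) = 0" by (simp add: measure_le_0_iff)
    then show ?thesis by (intro null_setsI) (auto simp: sets emeasure_eq_measure)
  qed
  have "compact (sphere 0 1 \<inter> V)"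
    using closed_subspace[OF V] by (intro compact_Int_closed) auto
  moreover have "open (ball v \<epsilon>)" for v by simp
  moreover have "sphere 0 1 \<inter> V \<subseteq> (\<Union>v\<in>sphere 0 1 \<inter> V. ball v \<epsilon>)"
    using \<epsilon> by auto
  ultimately obtain D where D: "D \<subseteq> sphere 0 1 \<inter> V" "finite D" "sphere 0 1 \<inter> V \<subseteq> (\<Union>v\<in>D. ball v \<epsilon>)"
    by (rule compactE_image)
  have "(\<Union>v\<in>D. ball v \<epsilon>) \<in> null_sets \<mu>"
  proof (intro null_sets_UN' countable_finite D(2))
    fix v assume "v \<in> D"
    then have "v \<in> sphere 0 1 \<inter> V" using D(1) by blast
    then show "ball v \<epsilon> \<in> null_sets \<mu>" by (intro null) auto
  qed
  then have "AE R in \<mu>. R \<notin> (\<Union>v\<in>D. ball v \<epsilon>)" by (rule AE_not_in)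
  with \<mu>(2) AV have "AE R in \<mu>. False"
    by eventually_elim (use D(3) in auto)
  then show False by simp
qed

text \<open>
  Averages \<open>f\<close> over the spherical cap around \<open>sgn R\<close>. Both the \<open>\<mu>\<close>-measure of a cap and its
  weight under \<open>\<nu>\<close> are independent of the centre, so Fubini's theorem identifies the integrals as
  the radius of the caps tends to \<open>0\<close>; no Haar measure on the orthogonal group is needed.
\<close>

lemma invariant_mean_homogeneous:
  fixes f :: "'b::euclidean_space \<Rightarrow> real"
  assumes V: "subspace V" and \<mu>: "invariant_measure V \<mu>" and unit: "AE R in \<mu>. norm R = 1"
    and \<nu>: "invariant_measure V \<nu>"
    and hom: "\<And>r R. r \<ge> 0 \<Longrightarrow> f (r *\<^sub>R R) = r * f R"
    and lip: "\<And>R R'. \<bar>f R - f R'\<bar> \<le> L * norm (R - R')"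
  shows "(\<integral>R. f R \<partial>\<nu>) = (\<integral>R. norm R \<partial>\<nu>) * (\<integral>R. f R \<partial>\<mu>)"
proof -
  obtain B where s\<mu> [measurable_cong]: "sets \<mu> = sets borel" and "prob_space \<mu>" and V\<mu>: "AE R in \<mu>. R \<in> V"
    and s\<nu> [measurable_cong]: "sets \<nu> = sets borel" and "prob_space \<nu>" and V\<nu>: "AE R in \<nu>. R \<in> V"
    and B: "AE R in \<nu>. norm R \<le> B"
    using \<mu> \<nu> unfolding invariant_measure_def by auto
  interpret \<mu>: prob_space \<mu> by fact
  interpret \<nu>: prob_space \<nu> by fact
  interpret P: pair_prob_space \<nu> \<mu> ..
  have L: "L \<ge> 0"
  proof -
    obtain b :: 'b where "norm b = 1" using vector_choose_size[of 1] by auto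
    then show ?thesis using order_trans[OF abs_ge_zero lip[of b 0]] by simp
  qed
  have f0: "f 0 = 0" using hom[of 0 0] by simp
  have fL: "\<bar>f R\<bar> \<le> L * norm R" for R using lip[of R 0] f0 by simp
  have "continuous_on UNIV f"
  proof (rule continuous_on_real_range[THEN iffD2], intro ballI allI impI)
    fix x :: 'b and e :: real assume e: "0 < e"
    show "\<exists>d>0. \<forall>x'\<in>UNIV. norm (x' - x) < d \<longrightarrow> \<bar>f x' - f x\<bar> < e"
    proof (intro exI[of _ "e / (L + 1)"] conjI ballI impI)
      fix x' assume "norm (x' - x) < e / (L + 1)"
      then have "(L + 1) * norm (x' - x) < e" using L by (simp add: less_divide_eq mult.commute)
      moreover have "L * norm (x' - x) \<le> (L + 1) * norm (x' - x)" by (intro mult_right_mono) auto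
      ultimately show "\<bar>f x' - f x\<bar> < e" using lip[of x' x] by linarith
    qed (use e L in auto)
  qed
  then have fm [measurable]: "f \<in> borel_measurable borel" by (rule borel_measurable_continuous_onI)
  obtain w where w: "w \<in> V" "norm w = 1"
  proof -
    have "\<exists>R. R \<in> V \<and> norm R = 1"
    proof (rule ccontr)
      assume no: "\<not> ?thesis"
      from unit V\<mu> have "AE R in \<mu>. False" by eventually_elim (use no in auto)
      then show False by simp
    qed
    with that show thesis by blast
  qed
  define N where "N = (\<integral>R. norm R \<partial>\<nu>)"
  define m where "m = (\<integral>R. f R \<partial>\<mu>)"
  have N0: "N \<ge> 0" unfolding N_def by simp
  have intN: "integrable \<nu> norm"
    by (rule \<nu>.integrable_const_bound[where B = B]) (use B in auto)
  have intf: "integrable \<nu> f"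
    by (rule Bochner_Integration.integrable_bound[where f = "\<lambda>R. L * norm R"]) (use intN fL L in auto)
  have intf\<mu>: "integrable \<mu> f"
    by (rule \<mu>.integrable_const_bound[where B = L]) (use unit fL in \<open>auto elim!: eventually_mono, metis mult_1_right\<close>)
  have main: "\<bar>N * m - (\<integral>R. f R \<partial>\<nu>)\<bar> \<le> L * \<epsilon> * N" if \<epsilon>: "\<epsilon> > 0" for \<epsilon>
  proof -
    \<comment> \<open>The kernel tests whether \<open>S\<close> is close to the direction of
      \<open>R\<close>. Integrated over \<open>S\<close> it gives \<open>c\<close> for every nonzero
      R in V (\<open>kint\<close>); integrated over \<open>R\<close> with weight
      \<open>norm R\<close> it gives \<open>D\<close> for every unit S in V
      (\<open>inner\<close>).\<close>
    define k :: "'b \<Rightarrow> 'b \<Rightarrow> real" where "k R S = indicator (ball S \<epsilon>) (sgn R)" for R S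
    have km [measurable]: "(\<lambda>z. k (fst z) (snd z)) \<in> borel_measurable (\<nu> \<Otimes>\<^sub>M \<mu>)"
    proof -
      have "(\<lambda>z. (snd z, sgn (fst z))) \<in> measurable (\<nu> \<Otimes>\<^sub>M \<mu>) (borel \<Otimes>\<^sub>M borel)" by measurable
      from measurable_compose[OF this measurable_indicator_ball[of \<epsilon>]] show ?thesis
        by (simp add: k_def)
    qed
    have k01: "0 \<le> k R S" "k R S \<le> 1" for R S by (auto simp: k_def indicator_def)
    define c where "c = cap_weight \<mu> \<epsilon> w"
    have c: "c > 0" unfolding c_def by (rule cap_weight_pos[OF \<mu> unit V w \<epsilon>])
    have kS [measurable]: "k R \<in> borel_measurable \<mu>" for R
      using measurable_compose[OF measurable_Pair1'[of R \<nu> \<mu>] km] sets_eq_imp_space_eq[OF s\<nu>] by simp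
    have kint: "(\<integral>S. k R S \<partial>\<mu>) = c" if "R \<in> V" "R \<noteq> 0" for R
    proof -
      have "sgn R \<in> V" using V that(1) by (simp add: sgn_div_norm subspace_scale)
      moreover have "norm (sgn R) = 1" using that(2) by (simp add: norm_sgn)
      moreover have "(\<integral>S. k R S \<partial>\<mu>) = (\<integral>S. indicator (ball (sgn R) \<epsilon>) S \<partial>\<mu>)"
        by (intro Bochner_Integration.integral_cong) (auto simp: k_def indicator_def dist_commute)
      moreover have "\<dots> = measure \<mu> (ball (sgn R) \<epsilon>)"
        using sets_eq_imp_space_eq[OF s\<mu>] by (simp add: s\<mu>)
      ultimately show ?thesis
        using cap_weight_unit[OF \<mu> unit, of \<epsilon>] cap_weight_rotate[OF \<mu> V w, of "sgn R" \<epsilon>] unfolding c_def by simp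
    qed
    have intk: "integrable \<mu> (k R)" for R
      by (rule \<mu>.integrable_const_bound[where B = 1]) (use k01 in auto)
    have intkf: "integrable \<mu> (\<lambda>S. k R S * f S)" for R
      by (rule Bochner_Integration.integrable_bound[OF intf\<mu>])
        (use k01 in \<open>auto simp: abs_mult intro!: mult_left_le_one_le\<close>)
    \<comment> \<open>By the Lipschitz condition \<open>I R\<close> is \<open>c * f R\<close> up to
      an error of order \<epsilon>, whereas exchanging the integrals evaluates its mean exactly as
      \<open>D * m\<close>.\<close>
    define I where "I R = norm R * (\<integral>S. k R S * f S \<partial>\<mu>)" for R
    have close: "\<bar>I R - c * f R\<bar> \<le> L * \<epsilon> * c * norm R" if R: "R \<in> V" for R
    proof (cases "R = 0")
      case False
      have fR: "f R = norm R * f (sgn R)"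
        using hom[of "norm R" "sgn R"] False by (simp add: sgn_div_norm)
      have "I R - c * f R = norm R * ((\<integral>S. k R S * f S \<partial>\<mu>) - (\<integral>S. k R S \<partial>\<mu>) * f (sgn R))"
        unfolding I_def fR kint[OF R False] by (simp add: algebra_simps)
      also have "\<dots> = norm R * (\<integral>S. k R S * (f S - f (sgn R)) \<partial>\<mu>)"
        using intk intkf by (simp add: right_diff_distrib)
      finally have eq: "I R - c * f R = norm R * (\<integral>S. k R S * (f S - f (sgn R)) \<partial>\<mu>)" .
      have "\<bar>\<integral>S. k R S * (f S - f (sgn R)) \<partial>\<mu>\<bar> \<le> (\<integral>S. \<bar>k R S * (f S - f (sgn R))\<bar> \<partial>\<mu>)"
        by (rule integral_abs_bound)
      also have "\<dots> \<le> (\<integral>S. L * \<epsilon> * k R S \<partial>\<mu>)"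
      proof (rule integral_mono)
        show "integrable \<mu> (\<lambda>S. \<bar>k R S * (f S - f (sgn R))\<bar>)"
          using intk intkf by (simp add: right_diff_distrib)
        show "integrable \<mu> (\<lambda>S. L * \<epsilon> * k R S)" using intk by simp
        fix S
        show "\<bar>k R S * (f S - f (sgn R))\<bar> \<le> L * \<epsilon> * k R S"
        proof (cases "dist S (sgn R) < \<epsilon>")
          case True
          have "\<bar>f S - f (sgn R)\<bar> \<le> L * dist S (sgn R)" using lip by (simp add: dist_norm)
          also have "\<dots> \<le> L * \<epsilon>" using True L by (intro mult_left_mono) auto
          finally show ?thesis using True by (simp add: k_def)
        qed (simp add: k_def)
      qed
      also have "\<dots> = L * \<epsilon> * c" using kint[OF R False] by simp
      finally have "norm R * \<bar>\<integral>S. k R S * (f S - f (sgn R)) \<partial>\<mu>\<bar> \<le> norm R * (L * \<epsilon> * c)"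
        by (intro mult_left_mono) auto
      then show ?thesis unfolding eq abs_mult by (simp add: mult_ac)
    qed (simp add: I_def f0)
    have AEb: "AE z in \<nu> \<Otimes>\<^sub>M \<mu>. norm (fst z) \<le> B \<and> norm (snd z) = 1"
    proof (rule P.AE_pair_measure)
      show "AE x in \<nu>. AE y in \<mu>. norm (fst (x, y)) \<le> B \<and> norm (snd (x, y)) = 1"
        using B by eventually_elim (use unit in auto)
    qed measurable
    have intg: "integrable (\<nu> \<Otimes>\<^sub>M \<mu>) (\<lambda>(R, S). norm R * k R S * g S)"
      if [measurable]: "g \<in> borel_measurable borel" and g: "\<And>S. \<bar>g S\<bar> \<le> C * norm S" "C \<ge> 0" for g C
    proof (rule P.integrable_const_bound[where B = "B * C"])
      show "AE z in \<nu> \<Otimes>\<^sub>M \<mu>. norm (case z of (R, S) \<Rightarrow> norm R * k R S * g S) \<le> B * C"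
        using AEb
      proof eventually_elim
        case (elim z)
        have "norm (fst z) * k (fst z) (snd z) * \<bar>g (snd z)\<bar> \<le> B * 1 * C"
          using elim k01 g(1)[of "snd z"] g(2)
          by (intro mult_mono mult_nonneg_nonneg) (auto intro: order_trans[OF norm_ge_zero])
        then show ?case using k01 by (simp add: split_def abs_mult)
      qed
      have "(\<lambda>z. norm (fst z) * k (fst z) (snd z) * g (snd z)) \<in> borel_measurable (\<nu> \<Otimes>\<^sub>M \<mu>)" by measurable
      then show "(\<lambda>(R, S). norm R * k R S * g S) \<in> borel_measurable (\<nu> \<Otimes>\<^sub>M \<mu>)" by (simp add: split_def)
    qed
    define D where "D = cap_weight \<nu> \<epsilon> w"
    have inner: "(\<integral>R. norm R * k R S * g S \<partial>\<nu>) = D * g S" if "S \<in> V" "norm S = 1" for S and g :: "'b \<Rightarrow> real"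
      using cap_weight_rotate[OF \<nu> V w that, of \<epsilon>] unfolding D_def cap_weight_def k_def by simp
    have swap: "(\<integral>R. (\<integral>S. norm R * k R S * g S \<partial>\<mu>) \<partial>\<nu>) = D * (\<integral>S. g S \<partial>\<mu>)"
      if gm [measurable]: "g \<in> borel_measurable borel" and g: "\<And>S. norm S = 1 \<Longrightarrow> \<bar>g S\<bar> \<le> C" for g :: "'b \<Rightarrow> real" and C
    proof -
      \<comment> \<open>Cutting g off away from the unit sphere turns its bound there into a linear
        growth bound everywhere, as \<open>intg\<close> requires; \<mu>-almost everywhere nothing
        changes.\<close>
      define g' where "g' S = (if norm S = 1 then g S else 0)" for S
      have g'm [measurable]: "g' \<in> borel_measurable borel" unfolding g'_def by measurable
      have C: "0 \<le> C" using g[OF w(2)] by linarith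
      have "\<bar>g' S\<bar> \<le> C * norm S" for S
        using g[of S] C unfolding g'_def by auto
      note int = intg[OF g'm this C]
      have g'eq: "AE S in \<mu>. g' S = g S"
        using unit by eventually_elim (simp add: g'_def)
      have "(\<integral>R. (\<integral>S. norm R * k R S * g S \<partial>\<mu>) \<partial>\<nu>) = (\<integral>R. (\<integral>S. norm R * k R S * g' S \<partial>\<mu>) \<partial>\<nu>)"
      proof (rule Bochner_Integration.integral_cong[OF refl], rule integral_cong_AE)
        fix R
        show "AE S in \<mu>. norm R * k R S * g S = norm R * k R S * g' S"
          using g'eq by eventually_elim simp
      qed measurable
      also have "\<dots> = (\<integral>S. (\<integral>R. norm R * k R S * g' S \<partial>\<nu>) \<partial>\<mu>)"
        using P.Fubini_integral[OF int] by simp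
      also have "\<dots> = (\<integral>S. D * g S \<partial>\<mu>)"
      proof (rule integral_cong_AE)
        have "(\<lambda>z. norm (fst z) * k (fst z) (snd z) * g' (snd z)) \<in> borel_measurable (\<nu> \<Otimes>\<^sub>M \<mu>)" by measurable
        then show "(\<lambda>S. \<integral>R. norm R * k R S * g' S \<partial>\<nu>) \<in> borel_measurable \<mu>"
          using P.integrable_snd[OF int] by (simp add: borel_measurable_integrable)
        show "AE S in \<mu>. (\<integral>R. norm R * k R S * g' S \<partial>\<nu>) = D * g S"
          using V\<mu> unit g'eq by eventually_elim (simp only: inner)
      qed measurable
      finally show ?thesis by simp
    qed
    \<comment> \<open>The constant function 1 links the two cap constants, \<open>D = N * c\<close>,
      so that \<open>c\<close> cancels from the final estimate.\<close>
    have "D = (\<integral>R. (\<integral>S. norm R * k R S * 1 \<partial>\<mu>) \<partial>\<nu>)"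
      using swap[of "\<lambda>_. 1" 1] by (simp add: \<mu>.prob_space)
    also have "\<dots> = (\<integral>R. norm R * c \<partial>\<nu>)"
    proof (rule integral_cong_AE)
      have "(\<lambda>R. \<integral>S. (\<lambda>(R, S). norm R * k R S * 1) (R, S) \<partial>\<mu>) \<in> borel_measurable \<nu>"
      proof (rule \<mu>.borel_measurable_lebesgue_integral)
        have "(\<lambda>z. norm (fst z) * k (fst z) (snd z) * 1) \<in> borel_measurable (\<nu> \<Otimes>\<^sub>M \<mu>)" by measurable
        then show "(\<lambda>(R, S). (\<lambda>(R, S). norm R * k R S * 1) (R, S)) \<in> borel_measurable (\<nu> \<Otimes>\<^sub>M \<mu>)"
          by (simp add: split_def)
      qed
      then show "(\<lambda>R. \<integral>S. norm R * k R S * 1 \<partial>\<mu>) \<in> borel_measurable \<nu>" by simp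
      show "AE R in \<nu>. (\<integral>S. norm R * k R S * 1 \<partial>\<mu>) = norm R * c"
        using V\<nu>
      proof eventually_elim
        case (elim R)
        then show ?case using kint[OF elim] by (cases "R = 0") auto
      qed
    qed measurable
    finally have D: "D = N * c" unfolding N_def by simp
    have Im: "I \<in> borel_measurable \<nu>"
    proof -
      have "(\<lambda>R. \<integral>S. (\<lambda>(R, S). k R S * f S) (R, S) \<partial>\<mu>) \<in> borel_measurable \<nu>"
      proof (rule \<mu>.borel_measurable_lebesgue_integral)
        have "(\<lambda>z. k (fst z) (snd z) * f (snd z)) \<in> borel_measurable (\<nu> \<Otimes>\<^sub>M \<mu>)" by measurable
        then show "(\<lambda>(R, S). (\<lambda>(R, S). k R S * f S) (R, S)) \<in> borel_measurable (\<nu> \<Otimes>\<^sub>M \<mu>)"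
          by (simp add: split_def)
      qed
      then have [measurable]: "(\<lambda>R. \<integral>S. k R S * f S \<partial>\<mu>) \<in> borel_measurable \<nu>" by simp
      show ?thesis unfolding I_def by measurable
    qed
    have intI: "integrable \<nu> I"
    proof (rule Bochner_Integration.integrable_bound[where f = "\<lambda>R. (L * \<epsilon> * c + c * L) * norm R"])
      show "AE R in \<nu>. norm (I R) \<le> norm ((L * \<epsilon> * c + c * L) * norm R)"
        using V\<nu>
      proof eventually_elim
        case (elim R)
        have "\<bar>c * f R\<bar> \<le> c * (L * norm R)" using c fL[of R] by (simp add: abs_mult)
        then have "\<bar>I R\<bar> \<le> (L * \<epsilon> * c + c * L) * norm R"
          using close[OF elim] by (simp add: algebra_simps)
        moreover have "0 \<le> L * \<epsilon> * c + c * L" using L \<epsilon> c by simp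
        ultimately show ?case by (simp add: abs_mult)
      qed
    qed (use intN Im in auto)
    have "(\<integral>R. I R \<partial>\<nu>) = D * m"
    proof -
      have "\<bar>f S\<bar> \<le> L" if "norm S = 1" for S using fL[of S] that by simp
      from swap[OF fm this] show ?thesis unfolding I_def m_def by (simp add: mult.assoc)
    qed
    then have "c * (N * m - (\<integral>R. f R \<partial>\<nu>)) = (\<integral>R. I R - c * f R \<partial>\<nu>)"
      using intI intf D by (simp add: algebra_simps)
    also have "\<bar>\<dots>\<bar> \<le> (\<integral>R. \<bar>I R - c * f R\<bar> \<partial>\<nu>)" by (rule integral_abs_bound)
    also have "\<dots> \<le> (\<integral>R. L * \<epsilon> * c * norm R \<partial>\<nu>)"
      using intI intf intN V\<nu> by (intro integral_mono_AE) (auto elim!: eventually_mono intro: close)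
    also have "\<dots> = c * (L * \<epsilon> * N)" unfolding N_def by simp
    finally show ?thesis using c by (simp add: abs_mult)
  qed
  have "\<bar>N * m - (\<integral>R. f R \<partial>\<nu>)\<bar> \<le> 0"
  proof (rule field_le_epsilon)
    fix e :: real assume e: "e > 0"
    have "L * N \<ge> 0" using L N0 by simp
    then have pos: "L * N + 1 > 0" by linarith
    then have "\<bar>N * m - (\<integral>R. f R \<partial>\<nu>)\<bar> \<le> L * (e / (L * N + 1)) * N" using e by (intro main) auto
    also have "\<dots> = e * (L * N / (L * N + 1))" by simp
    also have "\<dots> \<le> e * 1" using e pos by (intro mult_left_mono) auto
    finally show "\<bar>N * m - (\<integral>R. f R \<partial>\<nu>)\<bar> \<le> 0 + e" by simp
  qed
  then show ?thesis unfolding N_def m_def by simp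
qed

section \<open>Planar sets given by a support function\<close>

text \<open>Isolates the planar convex geometry: h plays the role of a support function, with no
  reference to probability.\<close>

locale planar_sublinear =
  fixes h :: "real \<Rightarrow> real \<Rightarrow> real"
  assumes add_le: "h (a + a') (b + b') \<le> h a b + h a' b'"
    and scale: "0 \<le> r \<Longrightarrow> h (r * a) (r * b) = r * h a b"
begin

definition supported_set :: "(real \<times> real) set" where
  "supported_set = {(x, y). \<forall>a b. a * x + b * y \<le> h a b}"

definition second_difference :: "real \<Rightarrow> real" where
  "second_difference b = h 1 b + h 1 (- b) - 2 * h 1 0"

lemma supported_set_D: "z \<in> supported_set \<Longrightarrow> a * fst z + b * snd z \<le> h a b"
  unfolding supported_set_def by auto

lemma closed_supported_set: "closed supported_set"
proof -
  have "supported_set = {z. \<forall>a b. a * fst z + b * snd z \<le> h a b}" unfolding supported_set_def by auto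
  then show ?thesis
    by (simp only:) (intro closed_Collect_all closed_Collect_le continuous_intros)
qed

text \<open>Sublinearity makes \<open>h 1\<close> convex, so its graph has a supporting line at 0.
  The slope becomes the second coordinate of a maximiser.\<close>

lemma subgradient_exists: "\<exists>y. \<forall>b. h 1 0 + b * y \<le> h 1 b"
proof -
  have "convex_on UNIV (h 1)"
  proof (rule convex_onI)
    fix t u v :: real assume t: "0 < t" "t < 1"
    have "h 1 ((1 - t) *\<^sub>R u + t *\<^sub>R v) = h ((1 - t) * 1 + t * 1) ((1 - t) * u + t * v)" by simp
    also have "\<dots> \<le> h ((1 - t) * 1) ((1 - t) * u) + h (t * 1) (t * v)" by (rule add_le)
    also have "\<dots> = (1 - t) * h 1 u + t * h 1 v" using t by (simp only: scale)
    finally show "h 1 ((1 - t) *\<^sub>R u + t *\<^sub>R v) \<le> (1 - t) * h 1 u + t * h 1 v" .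
  qed simp
  from convex_le_Inf_differential[OF this, of 0] obtain y
    where "\<And>b. h 1 0 + y * (b - 0) \<le> h 1 b" by fastforce
  then show ?thesis by (intro exI[of _ y]) (simp add: mult.commute)
qed

text \<open>The inequality is given only for directions with first coordinate 1. Homogeneity extends
  it to a > 0. For a \<le> 0, (1, b) is the sum of (a, b) and (1 - a, 0), and subadditivity
  transfers the bound.\<close>

lemma support_point_in_supported_set:
  assumes "\<And>b. h 1 0 + b * y \<le> h 1 b"
  shows "(h 1 0, y) \<in> supported_set"
  unfolding supported_set_def
proof (clarify)
  fix a b
  show "a * h 1 0 + b * y \<le> h a b"
  proof (cases "a > 0")
    case True
    have "a * (h 1 0 + (b / a) * y) \<le> a * h 1 (b / a)"
      using True by (intro mult_left_mono assms) auto
    also have "\<dots> = h a b" using True scale[of a 1 "b / a"] by simp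
    finally show ?thesis using True by (simp add: algebra_simps)
  next
    case False
    have "h 1 b \<le> h a b + h (1 - a) 0" using add_le[of a "1 - a" b 0] by simp
    also have "h (1 - a) 0 = (1 - a) * h 1 0" using False scale[of "1 - a" 1 0] by simp
    finally show ?thesis using assms[of b] by (simp add: algebra_simps)
  qed
qed

lemma fst_supported_set_le: "z \<in> supported_set \<Longrightarrow> fst z \<le> h 1 0"
  using supported_set_D[of z 1 0] by simp

text \<open>The face of the set in direction (1, 0) corresponds to the subdifferential of
  \<open>h 1\<close> at 0, so uniqueness of the maximiser becomes absence of a kink.\<close>

lemma x_maximiser_iff:
  "is_x_maximiser supported_set z \<longleftrightarrow> fst z = h 1 0 \<and> (\<forall>b. h 1 0 + b * snd z \<le> h 1 b)"
proof
  assume z: "is_x_maximiser supported_set z"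
  obtain y where "(h 1 0, y) \<in> supported_set" using subgradient_exists support_point_in_supported_set by blast
  with z have "h 1 0 \<le> fst z" "z \<in> supported_set" unfolding is_x_maximiser_def by auto
  with fst_supported_set_le have "fst z = h 1 0" by (simp add: antisym)
  moreover have "1 * fst z + b * snd z \<le> h 1 b" for b
    using \<open>z \<in> supported_set\<close> by (rule supported_set_D)
  ultimately show "fst z = h 1 0 \<and> (\<forall>b. h 1 0 + b * snd z \<le> h 1 b)" by simp
next
  assume "fst z = h 1 0 \<and> (\<forall>b. h 1 0 + b * snd z \<le> h 1 b)"
  then show "is_x_maximiser supported_set z"
    using support_point_in_supported_set[of "snd z"] fst_supported_set_le unfolding is_x_maximiser_def by (cases z) auto
qed

text \<open>Two subgradients u > v, tested at b and at -b, would force the second difference to be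
  at least (u - v) b.\<close>

lemma unique_x_maximiser:
  assumes small: "\<And>\<epsilon>. \<epsilon> > 0 \<Longrightarrow> \<exists>b>0. second_difference b < \<epsilon> * b"
  shows "\<exists>!z. is_x_maximiser supported_set z"
proof -
  obtain y where y: "\<And>b. h 1 0 + b * y \<le> h 1 b" using subgradient_exists by blast
  have "u \<le> v" if u: "\<And>b. h 1 0 + b * u \<le> h 1 b" and v: "\<And>b. h 1 0 + b * v \<le> h 1 b" for u v
  proof (rule ccontr)
    assume "\<not> u \<le> v"
    then obtain b where b: "b > 0" "second_difference b < (u - v) * b"
      using small[of "u - v"] by auto
    from u[of b] v[of "- b"] have "(u - v) * b \<le> second_difference b"
      unfolding second_difference_def by (simp add: algebra_simps)
    with b show False by simp
  qed
  then have "v = y" if "\<And>b. h 1 0 + b * v \<le> h 1 b" for v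
    using that y by (intro antisym) auto
  then show ?thesis
    using y by (intro ex1I[of _ "(h 1 0, y)"]) (auto simp: x_maximiser_iff prod_eq_iff)
qed

text \<open>Points of the set bound the support function from below. Curvature below k keeps the
  boundary curve above the parabola \<open>h 1 0 - q * t\<^sup>2 / 2\<close> in the x-direction, for
  some q < k; testing (1, b) and (1, -b) at c(t) and c(-t) with the best t gives nearly
  b^2/q.\<close>

lemma curvature_second_difference:
  assumes max: "is_x_maximiser supported_set z" and curv: "has_curvature supported_set z \<kappa>" and \<kappa>: "\<kappa> < ereal k"
  shows "eventually (\<lambda>b. b\<^sup>2 / k \<le> second_difference b) (at_right 0)"
proof -
  \<comment> \<open>A vertex would have infinite curvature, so the bound on \<kappa> leaves only the
    case of a parametrised boundary.\<close>
  obtain c c' e a where e: "0 < e" and c0: "c 0 = z"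
    and "\<forall>t\<in>{-e<..<e}. (c has_vector_derivative c' t) (at t) \<and> norm (c' t) = 1"
    and img: "c ` {-e<..<e} \<subseteq> frontier supported_set"
    and a: "(c' has_vector_derivative a) (at 0)" and \<kappa>a: "\<kappa> = ereal (norm a)"
    using curv \<kappa> unfolding has_curvature_def by (elim disjE) (simp, blast)
  then have c': "\<And>t. \<bar>t\<bar> < e \<Longrightarrow> (c has_vector_derivative c' t) (at t)"
    and unit: "\<And>t. \<bar>t\<bar> < e \<Longrightarrow> norm (c' t) = 1"
    by (auto simp: abs_less_iff)
  have ka: "norm a < k" using \<kappa> \<kappa>a by simp
  \<comment> \<open>The gap between \<open>norm a\<close> and q absorbs the error in differentiating
    c'; the gap between q and k absorbs the error in the y-coordinate.\<close>
  obtain q where q: "norm a < q" "q < k" using ka dense by blast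
  have q0: "q > 0" and k0: "k > 0" using q norm_ge_zero[of a] by linarith+
  \<comment> \<open>Chosen so that (1 - 2\<eta>)/q = 1/k.\<close>
  define \<eta> where "\<eta> = (1 - q / k) / 2"
  have \<eta>: "\<eta> > 0" unfolding \<eta>_def using q k0 by simp
  have inK: "c t \<in> supported_set" if "\<bar>t\<bar> < e" for t
  proof -
    have "t \<in> {-e<..<e}" using that by auto
    then have "c t \<in> frontier supported_set" using img by blast
    then show ?thesis using frontier_subset_closed[OF closed_supported_set] by blast
  qed
  have d1: "((\<lambda>t. fst (c t)) has_real_derivative fst (c' t)) (at t)"
    and d2: "((\<lambda>t. snd (c t)) has_real_derivative snd (c' t)) (at t)" if "\<bar>t\<bar> < e" for t
    unfolding has_real_derivative_iff_has_vector_derivative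
    using bounded_linear.has_vector_derivative[OF bounded_linear_fst c'[OF that]]
      bounded_linear.has_vector_derivative[OF bounded_linear_snd c'[OF that]] by auto
  have d3: "((\<lambda>t. fst (c' t)) has_real_derivative fst a) (at 0)"
    unfolding has_real_derivative_iff_has_vector_derivative
    by (rule bounded_linear.has_vector_derivative[OF bounded_linear_fst a])
  have z: "fst z = h 1 0" using max x_maximiser_iff by blast
  \<comment> \<open>The x-coordinate is maximal at z, so the tangent there is vertical. The
    unit-speed condition then leaves only the orientation \<sigma>, which is 1 or -1.\<close>
  have zero: "fst (c' 0) = 0"
  proof (rule DERIV_local_max[OF d1 e])
    show "\<forall>t. \<bar>0 - t\<bar> < e \<longrightarrow> fst (c t) \<le> fst (c 0)"
      using fst_supported_set_le[OF inK] c0 z by auto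
  qed (use e in simp)
  define \<sigma> where "\<sigma> = snd (c' 0)"
  have \<sigma>: "\<bar>\<sigma>\<bar> = 1" "\<sigma> * \<sigma> = 1"
  proof -
    show "\<bar>\<sigma>\<bar> = 1" using unit[of 0] e zero unfolding \<sigma>_def by (cases "c' 0") (simp add: norm_Pair power2_eq_1_iff, auto)
    then show "\<sigma> * \<sigma> = 1" by (metis abs_mult_self_eq mult_1)
  qed
  have quot: "\<exists>\<delta>>0. \<forall>s. \<bar>s\<bar> < \<delta> \<longrightarrow> \<bar>f s - f 0 - D * s\<bar> \<le> \<epsilon> * \<bar>s\<bar>"
    if "(f has_real_derivative D) (at 0)" "\<epsilon> > 0" for f :: "real \<Rightarrow> real" and D \<epsilon>
  proof -
    have "(\<lambda>s. (f (0 + s) - f 0) / s) \<midarrow>0\<rightarrow> D" using that(1) by (rule DERIV_D)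
    from LIM_D[OF this that(2)] obtain \<delta> where
      \<delta>: "\<delta> > 0" "\<And>s. s \<noteq> 0 \<Longrightarrow> \<bar>s\<bar> < \<delta> \<Longrightarrow> \<bar>(f s - f 0) / s - D\<bar> < \<epsilon>" by auto
    have "\<bar>f s - f 0 - D * s\<bar> \<le> \<epsilon> * \<bar>s\<bar>" if s: "\<bar>s\<bar> < \<delta>" for s
    proof (cases "s = 0")
      case False
      have "f s - f 0 - D * s = ((f s - f 0) / s - D) * s"
        using False by (simp add: field_simps)
      then have "\<bar>f s - f 0 - D * s\<bar> = \<bar>(f s - f 0) / s - D\<bar> * \<bar>s\<bar>"
        by (simp only: abs_mult)
      also have "\<dots> \<le> \<epsilon> * \<bar>s\<bar>" using \<delta>(2)[OF False s] by (intro mult_right_mono) auto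
      finally show ?thesis .
    qed simp
    with \<delta>(1) show ?thesis by blast
  qed
  obtain \<delta>1 where \<delta>1: "\<delta>1 > 0" "\<And>s. \<bar>s\<bar> < \<delta>1 \<Longrightarrow> \<bar>fst (c' s)\<bar> \<le> q * \<bar>s\<bar>"
  proof -
    obtain \<delta> where \<delta>: "\<delta> > 0" "\<And>s. \<bar>s\<bar> < \<delta> \<Longrightarrow> \<bar>fst (c' s) - fst (c' 0) - fst a * s\<bar> \<le> (q - norm a) * \<bar>s\<bar>"
      using quot[OF d3, of "q - norm a"] q by auto
    have "\<bar>fst (c' s)\<bar> \<le> q * \<bar>s\<bar>" if "\<bar>s\<bar> < \<delta>" for s
    proof -
      have "\<bar>fst a\<bar> \<le> norm a" using norm_fst_le[of "fst a" "snd a"] by simp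
      then have "\<bar>fst a * s\<bar> \<le> norm a * \<bar>s\<bar>" unfolding abs_mult by (rule mult_right_mono) simp
      with \<delta>(2)[OF that] zero have "\<bar>fst (c' s)\<bar> \<le> (q - norm a) * \<bar>s\<bar> + norm a * \<bar>s\<bar>" by linarith
      then show ?thesis by (simp add: algebra_simps)
    qed
    with \<delta>(1) that show thesis by blast
  qed
  obtain \<delta>2 where \<delta>2: "\<delta>2 > 0" "\<And>t. \<bar>t\<bar> < \<delta>2 \<Longrightarrow> \<bar>snd (c t) - snd z - \<sigma> * t\<bar> \<le> \<eta> * \<bar>t\<bar>"
    using quot[OF d2[of 0] \<eta>] e c0 unfolding \<sigma>_def by auto
  \<comment> \<open>Integrates \<open>\<bar>fst (c' s)\<bar> \<le> q * \<bar>s\<bar>\<close> by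
    monotonicity: after adding q s^2/2 the x-coordinate decreases up to 0 and increases
    afterwards.\<close>
  have low: "h 1 0 - q * t\<^sup>2 / 2 \<le> fst (c t)" if t: "\<bar>t\<bar> < e" "\<bar>t\<bar> < \<delta>1" for t
  proof -
    define g where "g s = fst (c s) + q * s\<^sup>2 / 2" for s
    have g': "(g has_real_derivative fst (c' s) + q * s) (at s)" if "\<bar>s\<bar> \<le> \<bar>t\<bar>" for s
      unfolding g_def by (rule derivative_eq_intros d1 refl | use that t in simp)+
    have bd: "\<bar>fst (c' s)\<bar> \<le> q * \<bar>s\<bar>" if "\<bar>s\<bar> \<le> \<bar>t\<bar>" for s
      using \<delta>1(2) that t by simp
    have "g 0 \<le> g t"
    proof (cases "t \<ge> 0")
      case True
      show ?thesis
      proof (rule DERIV_nonneg_imp_nondecreasing[OF True])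
        fix s assume "0 \<le> s" "s \<le> t"
        then show "\<exists>y. (g has_real_derivative y) (at s) \<and> 0 \<le> y"
          using g'[of s] bd[of s] by (intro exI[of _ "fst (c' s) + q * s"]) (auto simp: abs_le_iff)
      qed
    next
      case False
      show ?thesis
      proof (rule DERIV_nonpos_imp_nonincreasing[of t 0 g])
        fix s assume "t \<le> s" "s \<le> 0"
        then show "\<exists>y. (g has_real_derivative y) (at s) \<and> y \<le> 0"
          using g'[of s] bd[of s] by (intro exI[of _ "fst (c' s) + q * s"]) (auto simp: abs_le_iff)
      qed (use False in simp)
    qed
    then show ?thesis unfolding g_def using c0 z by simp
  qed
  define r where "r = q * min e (min \<delta>1 \<delta>2)"
  have r: "r > 0" unfolding r_def using q0 e \<delta>1(1) \<delta>2(1) by simp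
  have "b\<^sup>2 / k \<le> second_difference b" if b: "0 < b" "b < r" for b
  proof -
    txt \<open>The parameter \<open>t\<close> maximises \<open>\<sigma> * b * t - q * t\<^sup>2 / 2\<close>.\<close>
    define t where "t = \<sigma> * b / q"
    have at: "\<bar>t\<bar> = b / q" unfolding t_def using \<sigma> b q0 by (simp add: abs_mult)
    have "b / q < min e (min \<delta>1 \<delta>2)"
      using b unfolding r_def pos_divide_less_eq[OF q0] by (simp only: mult.commute)
    then have t: "\<bar>t\<bar> < e" "\<bar>t\<bar> < \<delta>1" "\<bar>t\<bar> < \<delta>2" using at by auto
    have tt: "q * t\<^sup>2 = b\<^sup>2 / q" "b * (\<sigma> * t) = b\<^sup>2 / q"
      unfolding t_def using \<sigma> q0 by (auto simp: power2_eq_square field_simps)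
    have supp: "fst (c s) + b' * snd (c s) \<le> h 1 b'" if "\<bar>s\<bar> < e" for s b'
    proof -
      have "1 * fst (c s) + b' * snd (c s) \<le> h 1 b'"
        using inK[OF that] by (rule supported_set_D)
      then show ?thesis by simp
    qed
    have s1: "b * (snd z + \<sigma> * t - \<eta> * \<bar>t\<bar>) \<le> b * snd (c t)"
      using \<delta>2(2)[of t] t b by (intro mult_left_mono) auto
    have s2: "b * (- snd z + \<sigma> * t - \<eta> * \<bar>t\<bar>) \<le> b * - snd (c (- t))"
      using \<delta>2(2)[of "- t"] t b by (intro mult_left_mono) auto
    have ebt: "b * (\<eta> * \<bar>t\<bar>) = \<eta> * (b\<^sup>2 / q)" using at by (simp add: power2_eq_square)
    \<comment> \<open>In the sum of the two tests the terms \<open>b * snd z\<close> cancel. The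
      tilt contributes 2 b^2/q and the two parabolas cost b^2/q.\<close>
    have "2 * h 1 0 + b\<^sup>2 / q - 2 * (\<eta> * (b\<^sup>2 / q)) \<le> h 1 b + h 1 (- b)"
      using supp[of t b] supp[of "- t" "- b"] low[of t] low[of "- t"] t s1 s2 tt ebt
      by (simp add: algebra_simps)
    moreover have "b\<^sup>2 / q - 2 * (\<eta> * (b\<^sup>2 / q)) = b\<^sup>2 / k"
      unfolding \<eta>_def using q0 k0 by (simp add: field_simps)
    ultimately show ?thesis unfolding second_difference_def by simp
  qed
  then show ?thesis unfolding eventually_at_right_field using r by blast
qed

end

section \<open>Second differences at random scoring functions\<close>

text \<open>Rotating S and T by the same orthogonal map preserves their joint law and commutes with
  the linear combination. The norm is at most 1 + |b|.\<close>

lemma invariant_measure_combination: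
  assumes \<mu>: "invariant_measure V \<mu>" and unit: "AE R in \<mu>. norm R = 1" and V: "subspace V"
  shows "invariant_measure V (distr (\<mu> \<Otimes>\<^sub>M \<mu>) borel (\<lambda>(S, T). S + b *\<^sub>R T))" (is "invariant_measure V ?\<nu>")
proof -
  have s [measurable_cong]: "sets \<mu> = sets borel" and "prob_space \<mu>" and V\<mu>: "AE R in \<mu>. R \<in> V"
    and inv: "\<And>f. orthogonal_transformation f \<Longrightarrow> f ` V = V \<Longrightarrow> distr \<mu> borel f = \<mu>"
    using \<mu> unfolding invariant_measure_def by auto
  interpret prob_space \<mu> by fact
  interpret P: pair_prob_space \<mu> \<mu> ..
  have m [measurable]: "(\<lambda>(S, T). S + b *\<^sub>R T) \<in> measurable (\<mu> \<Otimes>\<^sub>M \<mu>) borel" by measurable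
  have Vc: "closed V" using V by (rule closed_subspace)
  have [measurable]: "V \<in> sets borel" using Vc by simp
  have AEp: "AE z in \<mu> \<Otimes>\<^sub>M \<mu>. (fst z \<in> V \<and> norm (fst z) = 1) \<and> snd z \<in> V \<and> norm (snd z) = 1"
  proof (rule P.AE_pair_measure)
    have AE1: "AE R in \<mu>. R \<in> V \<and> norm R = 1" using V\<mu> unit by eventually_elim simp
    then show "AE x in \<mu>. AE y in \<mu>. (fst (x, y) \<in> V \<and> norm (fst (x, y)) = 1) \<and> snd (x, y) \<in> V \<and> norm (snd (x, y)) = 1"
      by eventually_elim (use AE1 in auto)
  qed measurable
  show ?thesis
    unfolding invariant_measure_def
  proof (intro conjI allI impI exI[of _ "1 + \<bar>b\<bar>"])
    show "prob_space ?\<nu>" by (rule P.prob_space_distr) (rule m)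
    show "sets ?\<nu> = sets borel" by simp
    have "AE z in \<mu> \<Otimes>\<^sub>M \<mu>. (case z of (S, T) \<Rightarrow> S + b *\<^sub>R T) \<in> V"
      using AEp by eventually_elim (auto intro!: subspace_add[OF V] subspace_scale[OF V])
    then show "AE R in ?\<nu>. R \<in> V" by (subst AE_distr_iff[OF m]) auto
    have "AE z in \<mu> \<Otimes>\<^sub>M \<mu>. norm (case z of (S, T) \<Rightarrow> S + b *\<^sub>R T) \<le> 1 + \<bar>b\<bar>"
      using AEp
    proof eventually_elim
      case (elim z)
      then show ?case using norm_triangle_ineq[of "fst z" "b *\<^sub>R snd z"] by (simp add: split_def)
    qed
    then show "AE R in ?\<nu>. norm R \<le> 1 + \<bar>b\<bar>" by (subst AE_distr_iff[OF m]) auto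
    fix f assume f: "orthogonal_transformation f \<and> f ` V = V"
    then have lin: "linear f" using orthogonal_transformation_linear by blast
    have fm [measurable]: "f \<in> borel_measurable borel"
      using borel_measurable_continuous_onI[OF linear_continuous_on[OF lin[unfolded linear_conv_bounded_linear]]] .
    have "\<mu> \<Otimes>\<^sub>M \<mu> = distr \<mu> borel f \<Otimes>\<^sub>M distr \<mu> borel f" using inv f by simp
    also have "\<dots> = distr (\<mu> \<Otimes>\<^sub>M \<mu>) (borel \<Otimes>\<^sub>M borel) (\<lambda>(x, y). (f x, f y))"
    proof (rule pair_measure_distr)
      show "sigma_finite_measure (distr \<mu> borel f)"
        using inv f by (simp add: sigma_finite_measure_axioms)
    qed measurable
    finally have rot: "\<mu> \<Otimes>\<^sub>M \<mu> = distr (\<mu> \<Otimes>\<^sub>M \<mu>) (borel \<Otimes>\<^sub>M borel) (\<lambda>(x, y). (f x, f y))" .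
    have "distr ?\<nu> borel f = distr (\<mu> \<Otimes>\<^sub>M \<mu>) borel (\<lambda>(S, T). f S + b *\<^sub>R f T)"
      by (subst distr_distr) (auto simp: o_def split_def linear_add[OF lin] linear_scale[OF lin])
    also have "\<dots> = distr (distr (\<mu> \<Otimes>\<^sub>M \<mu>) (borel \<Otimes>\<^sub>M borel) (\<lambda>(x, y). (f x, f y))) borel (\<lambda>(S, T). S + b *\<^sub>R T)"
      by (subst distr_distr) (auto simp: o_def split_def)
    also have "\<dots> = ?\<nu>" by (simp only: rot[symmetric])
    finally show "distr ?\<nu> borel f = ?\<nu>" .
  qed
qed

section \<open>The support function of a pair of scoring functions\<close>

lemma lam_nonneg_sum: "0 \<le> lam p R + lam p (- R)"
  using lam_add_le[of p R "- R"] lam_scale[of 0 p R] by simp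

lemma lam_lipschitz: "\<bar>lam p R - lam p R'\<bar> \<le> 5 * norm (R - R')"
  using lam_add_le[of p R' "R - R'"] lam_add_le[of p R "R' - R"]
    lam_le[of p "R - R'"] lam_le[of p "R' - R"] by (simp add: norm_minus_commute)

lemma planar_sublinear_lam: "planar_sublinear (\<lambda>a b. lam p (a *\<^sub>R S + b *\<^sub>R T))"
proof
  fix a a' b b' r :: real
  show "lam p ((a + a') *\<^sub>R S + (b + b') *\<^sub>R T) \<le> lam p (a *\<^sub>R S + b *\<^sub>R T) + lam p (a' *\<^sub>R S + b' *\<^sub>R T)"
    using lam_add_le[of p "a *\<^sub>R S + b *\<^sub>R T" "a' *\<^sub>R S + b' *\<^sub>R T"] by (simp add: algebra_simps)
  show "0 \<le> r \<Longrightarrow> lam p ((r * a) *\<^sub>R S + (r * b) *\<^sub>R T) = r * lam p (a *\<^sub>R S + b *\<^sub>R T)"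
    using lam_scale[of r p "a *\<^sub>R S + b *\<^sub>R T"] by (simp add: algebra_simps)
qed

lemma SET_eq_supported_set: "SET p S T = planar_sublinear.supported_set (\<lambda>a b. lam p (a *\<^sub>R S + b *\<^sub>R T))"
  unfolding SET_def planar_sublinear.supported_set_def[OF planar_sublinear_lam] ..

definition lam_second_difference :: "'a::finite pmf \<Rightarrow> real \<Rightarrow> 'a score \<times> 'a score \<Rightarrow> real" where
  "lam_second_difference p b z = lam p (fst z + b *\<^sub>R snd z) + lam p (fst z - b *\<^sub>R snd z) - 2 * lam p (fst z)"

lemma second_difference_lam:
  "planar_sublinear.second_difference (\<lambda>a b. lam p (a *\<^sub>R S + b *\<^sub>R T)) b = lam_second_difference p b (S, T)"
  unfolding planar_sublinear.second_difference_def[OF planar_sublinear_lam] lam_second_difference_def by simp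

lemma lam_second_difference_nonneg: "0 \<le> lam_second_difference p b z"
proof -
  have "2 * lam p (fst z) = lam p (2 *\<^sub>R fst z)" using lam_scale[of 2 p "fst z"] by simp
  also have "2 *\<^sub>R fst z = (fst z + b *\<^sub>R snd z) + (fst z - b *\<^sub>R snd z)" by (simp add: scaleR_2)
  also have "lam p \<dots> \<le> lam p (fst z + b *\<^sub>R snd z) + lam p (fst z - b *\<^sub>R snd z)" by (rule lam_add_le)
  finally show ?thesis unfolding lam_second_difference_def by simp
qed

lemma lam_borel_measurable [measurable]: "lam p \<in> borel_measurable borel"
proof (rule borel_measurable_continuous_onI, rule continuous_on_real_range[THEN iffD2], intro ballI allI impI)
  fix R :: "'a score" and e :: real assume e: "0 < e"
  show "\<exists>d>0. \<forall>R'\<in>UNIV. norm (R' - R) < d \<longrightarrow> \<bar>lam p R' - lam p R\<bar> < e"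
  proof (intro exI[of _ "e / 5"] conjI ballI impI)
    fix R' assume "norm (R' - R) < e / 5"
    then show "\<bar>lam p R' - lam p R\<bar> < e" using lam_lipschitz[of p R' R] by linarith
  qed (use e in simp)
qed

lemma norm_add_diff_le:
  fixes S T :: "'b::real_inner"
  assumes "norm S = 1" "norm T = 1"
  shows "norm (S + b *\<^sub>R T) + norm (S - b *\<^sub>R T) \<le> 2 + b\<^sup>2"
proof -
  let ?u = "norm (S + b *\<^sub>R T)" and ?v = "norm (S - b *\<^sub>R T)"
  have "?u\<^sup>2 + ?v\<^sup>2 = 2 * (norm S)\<^sup>2 + 2 * b\<^sup>2 * (norm T)\<^sup>2"
    unfolding power2_norm_eq_inner
    by (simp add: inner_add_left inner_add_right inner_diff_left inner_diff_right power2_eq_square algebra_simps)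
  then have par: "?u\<^sup>2 + ?v\<^sup>2 = 2 + 2 * b\<^sup>2" using assms by simp
  have "(?u + ?v)\<^sup>2 \<le> 2 * (?u\<^sup>2 + ?v\<^sup>2)"
    using zero_le_power2[of "?u - ?v"] by (simp add: power2_eq_square algebra_simps)
  \<comment> \<open>Adding b^4 completes the square, which removes the square root from the
    estimate.\<close>
  also have "\<dots> \<le> 2 * (2 + 2 * b\<^sup>2) + (b\<^sup>2)\<^sup>2" unfolding par by simp
  also have "\<dots> = (2 + b\<^sup>2)\<^sup>2" by (simp add: power2_eq_square algebra_simps)
  finally show ?thesis by (rule power2_le_imp_le) simp
qed

section \<open>Means of the limiting score and of its second differences\<close>

lemma uniform_on_sphereD:
  assumes "uniform_on_sphere V \<mu>" "subspace V"
  shows "invariant_measure V \<mu>" "AE R in \<mu>. norm R = 1"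
proof -
  have "prob_space \<mu>" and s: "sets \<mu> = sets borel" and e: "emeasure \<mu> {R \<in> V. norm R = 1} = 1"
    and inv: "\<forall>f. orthogonal_transformation f \<and> f ` V = V \<longrightarrow> distr \<mu> borel f = \<mu>"
    using assms(1) unfolding uniform_on_sphere_def by auto
  interpret prob_space \<mu> by fact
  have "prob {R \<in> V. norm R = 1} = 1" using e by (simp add: measure_def)
  then have *: "AE R in \<mu>. R \<in> {R \<in> V. norm R = 1}" by (rule AE_prob_1)
  then show "AE R in \<mu>. norm R = 1" by eventually_elim simp
  moreover have "AE R in \<mu>. R \<in> V" using * by eventually_elim simp
  moreover have "AE R in \<mu>. norm R \<le> 1" using * by eventually_elim simp
  ultimately show "invariant_measure V \<mu>"
    unfolding invariant_measure_def using s inv \<open>prob_space \<mu>\<close> by blast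
qed

lemma subspace_sym_scores: "subspace (sym_scores :: 'a::finite score set)"
  unfolding subspace_def sym_scores_def by auto

text \<open>R and -R have the same law, so twice the mean equals the mean of
  \<open>lam p R + lam p (- R)\<close>. On the unit sphere this sum lies between 0 (subadditivity)
  and \<open>sqrt 6\<close> (\<open>lam_width\<close>).\<close>

lemma integral_lam_bounds:
  fixes \<mu> :: "'a::finite score measure"
  assumes \<mu>: "invariant_measure sym_scores \<mu>" and unit: "AE R in \<mu>. norm R = 1"
  shows "0 \<le> (\<integral>R. lam p R \<partial>\<mu>)" "(\<integral>R. lam p R \<partial>\<mu>) \<le> sqrt 6 / 2"
proof -
  have s [measurable_cong]: "sets \<mu> = sets borel" and "prob_space \<mu>"
    and inv: "\<And>f. orthogonal_transformation f \<Longrightarrow> f ` sym_scores = sym_scores \<Longrightarrow> distr \<mu> borel f = \<mu>"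
    using \<mu> unfolding invariant_measure_def by auto
  interpret prob_space \<mu> by fact
  have "uminus ` (sym_scores :: 'a score set) = sym_scores"
  proof
    show "uminus ` (sym_scores :: 'a score set) \<subseteq> sym_scores"
      using subspace_neg[OF subspace_sym_scores] by blast
    show "sym_scores \<subseteq> uminus ` (sym_scores :: 'a score set)"
    proof
      fix R :: "'a score" assume "R \<in> sym_scores"
      then show "R \<in> uminus ` sym_scores"
        using subspace_neg[OF subspace_sym_scores] by (intro image_eqI[of _ _ "- R"]) auto
    qed
  qed
  moreover have "orthogonal_transformation (uminus :: 'a score \<Rightarrow> _)"
    by (simp add: orthogonal_transformation_neg)
  ultimately have neg: "distr \<mu> borel uminus = \<mu>" by (intro inv)
  have "(\<integral>R. lam p R \<partial>\<mu>) = (\<integral>R. lam p R \<partial>distr \<mu> borel uminus)" by (simp only: neg)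
  also have "\<dots> = (\<integral>R. lam p (- R) \<partial>\<mu>)" by (rule integral_distr) measurable
  finally have eq: "(\<integral>R. lam p R \<partial>\<mu>) = (\<integral>R. lam p (- R) \<partial>\<mu>)" .
  have lam0: "lam p 0 = 0" using lam_scale[of 0 p 0] by simp
  have bd: "\<bar>lam p R\<bar> \<le> 5 * norm R" for R using lam_lipschitz[of p R 0] lam0 by simp
  have int: "integrable \<mu> (lam p)"
    by (rule integrable_const_bound[where B = 5])
      (use unit in \<open>auto elim!: eventually_mono intro: order_trans[OF bd]\<close>)
  have int': "integrable \<mu> (\<lambda>R. lam p (- R))"
    by (rule integrable_const_bound[where B = 5])
      (use unit in \<open>auto elim!: eventually_mono intro: order_trans[OF bd]\<close>)
  have two: "2 * (\<integral>R. lam p R \<partial>\<mu>) = (\<integral>R. lam p R + lam p (- R) \<partial>\<mu>)"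
    using eq int int' by simp
  have "0 \<le> (\<integral>R. lam p R + lam p (- R) \<partial>\<mu>)"
    by (rule integral_nonneg_AE) (simp add: lam_nonneg_sum)
  with two show "0 \<le> (\<integral>R. lam p R \<partial>\<mu>)" by simp
  have "(\<integral>R. lam p R + lam p (- R) \<partial>\<mu>) \<le> (\<integral>R. sqrt 6 \<partial>\<mu>)"
  proof (rule integral_mono_AE)
    show "AE R in \<mu>. lam p R + lam p (- R) \<le> sqrt 6"
      using unit
    proof eventually_elim
      case (elim R)
      then show ?case using lam_width[of p R] by simp
    qed
  qed (use int int' in auto)
  with two show "(\<integral>R. lam p R \<partial>\<mu>) \<le> sqrt 6 / 2" by (simp add: prob_space)
qed

text \<open>Each of the three terms has mean equal to \<open>m\<close> times a mean norm, so the
  random second difference of \<open>lam\<close> reduces to a second difference of Euclidean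
  norms.\<close>

lemma integral_lam_second_difference_le:
  fixes \<mu> :: "'a::finite score measure"
  assumes \<mu>: "invariant_measure sym_scores \<mu>" and unit: "AE R in \<mu>. norm R = 1"
  shows "(\<integral>\<^sup>+z. ennreal (lam_second_difference p b z) \<partial>(\<mu> \<Otimes>\<^sub>M \<mu>)) \<le> ennreal (b\<^sup>2 * (\<integral>R. lam p R \<partial>\<mu>))"
proof -
  have s [measurable_cong]: "sets \<mu> = sets borel" and "prob_space \<mu>"
    using \<mu> unfolding invariant_measure_def by auto
  interpret prob_space \<mu> by fact
  interpret P: pair_prob_space \<mu> \<mu> ..
  define m where "m = (\<integral>R. lam p R \<partial>\<mu>)"
  have lam0: "lam p 0 = 0" using lam_scale[of 0 p 0] by simp
  have bd: "\<bar>lam p R\<bar> \<le> 5 * norm R" for R using lam_lipschitz[of p R 0] lam0 by simp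
  have AEp: "AE z in \<mu> \<Otimes>\<^sub>M \<mu>. norm (fst z) = 1 \<and> norm (snd z) = 1"
  proof (rule P.AE_pair_measure)
    show "AE x in \<mu>. AE y in \<mu>. norm (fst (x, y)) = 1 \<and> norm (snd (x, y)) = 1"
      using unit by eventually_elim (use unit in auto)
  qed measurable
  have AEb: "AE z in \<mu> \<Otimes>\<^sub>M \<mu>. norm (fst z + c *\<^sub>R snd z) \<le> 1 + \<bar>c\<bar>" for c
    using AEp
  proof eventually_elim
    case (elim z)
    then show ?case using norm_triangle_ineq[of "fst z" "c *\<^sub>R snd z"] by simp
  qed
  have intn: "integrable (\<mu> \<Otimes>\<^sub>M \<mu>) (\<lambda>z. norm (fst z + c *\<^sub>R snd z))" for c
    by (rule P.integrable_const_bound[where B = "1 + \<bar>c\<bar>"]) (use AEb in auto)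
  have intl: "integrable (\<mu> \<Otimes>\<^sub>M \<mu>) (\<lambda>z. lam p (fst z + c *\<^sub>R snd z))" for c
    by (rule Bochner_Integration.integrable_bound[where f = "\<lambda>z. 5 * norm (fst z + c *\<^sub>R snd z)"])
      (use intn bd in auto)
  have mean: "(\<integral>z. lam p (fst z + c *\<^sub>R snd z) \<partial>(\<mu> \<Otimes>\<^sub>M \<mu>))
      = (\<integral>z. norm (fst z + c *\<^sub>R snd z) \<partial>(\<mu> \<Otimes>\<^sub>M \<mu>)) * m" for c
  proof -
    let ?\<nu> = "distr (\<mu> \<Otimes>\<^sub>M \<mu>) borel (\<lambda>(S, T). S + c *\<^sub>R T)"
    have "(\<integral>R. lam p R \<partial>?\<nu>) = (\<integral>R. norm R \<partial>?\<nu>) * (\<integral>R. lam p R \<partial>\<mu>)"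
      by (rule invariant_mean_homogeneous[OF subspace_sym_scores \<mu> unit
            invariant_measure_combination[OF \<mu> unit subspace_sym_scores] lam_scale lam_lipschitz])
    then show ?thesis unfolding m_def by (simp add: integral_distr split_def)
  qed
  let ?N = "\<lambda>c. \<integral>z. norm (fst z + c *\<^sub>R snd z) \<partial>(\<mu> \<Otimes>\<^sub>M \<mu>)"
  have N0: "?N 0 = 1"
  proof -
    have "?N 0 = (\<integral>z. 1 \<partial>(\<mu> \<Otimes>\<^sub>M \<mu>))"
      by (rule integral_cong_AE) (use AEp in \<open>auto elim!: eventually_mono\<close>)
    then show ?thesis by (simp add: P.prob_space)
  qed
  have "?N b + ?N (- b) = (\<integral>z. norm (fst z + b *\<^sub>R snd z) + norm (fst z + (- b) *\<^sub>R snd z) \<partial>(\<mu> \<Otimes>\<^sub>M \<mu>))"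
    by (rule Bochner_Integration.integral_add[OF intn intn, symmetric])
  also have "\<dots> \<le> (\<integral>z. 2 + b\<^sup>2 \<partial>(\<mu> \<Otimes>\<^sub>M \<mu>))"
  proof (rule integral_mono_AE)
    show "AE z in \<mu> \<Otimes>\<^sub>M \<mu>. norm (fst z + b *\<^sub>R snd z) + norm (fst z + (- b) *\<^sub>R snd z) \<le> 2 + b\<^sup>2"
      using AEp
    proof eventually_elim
      case (elim z)
      then show ?case using norm_add_diff_le[of "fst z" "snd z" b] by simp
    qed
  qed (use Bochner_Integration.integrable_add[OF intn[of b] intn[of "- b"]] in auto)
  finally have N: "?N b + ?N (- b) - 2 \<le> b\<^sup>2" by (simp add: P.prob_space)
  \<comment> \<open>All three terms take the form S + cT with c = b, -b, 0, to which
    \<open>mean\<close> applies.\<close>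
  have d: "lam_second_difference p b = (\<lambda>z. lam p (fst z + b *\<^sub>R snd z) + lam p (fst z + (- b) *\<^sub>R snd z)
      - 2 * lam p (fst z + 0 *\<^sub>R snd z))"
    by (auto simp: lam_second_difference_def fun_eq_iff)
  have "(\<integral>z. lam_second_difference p b z \<partial>(\<mu> \<Otimes>\<^sub>M \<mu>)) = (?N b + ?N (- b) - 2 * ?N 0) * m"
    unfolding d using intl[of b] intl[of "- b"] intl[of 0] mean[of b] mean[of "- b"] mean[of 0]
    by (simp del: scaleR_minus_left scaleR_zero_left add: algebra_simps)
  \<comment> \<open>The norm estimate may be multiplied by \<open>m\<close> because the mean score
    is nonnegative.\<close>
  also have "\<dots> \<le> b\<^sup>2 * m"
    using N N0 integral_lam_bounds(1)[OF \<mu> unit] unfolding m_def by (intro mult_right_mono) auto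
  finally have le: "(\<integral>z. lam_second_difference p b z \<partial>(\<mu> \<Otimes>\<^sub>M \<mu>)) \<le> b\<^sup>2 * m" .
  have "integrable (\<mu> \<Otimes>\<^sub>M \<mu>) (lam_second_difference p b)"
    unfolding d by (intro Bochner_Integration.integrable_diff Bochner_Integration.integrable_add integrable_mult_right intl)
  then have "(\<integral>\<^sup>+z. ennreal (lam_second_difference p b z) \<partial>(\<mu> \<Otimes>\<^sub>M \<mu>))
      = ennreal (\<integral>z. lam_second_difference p b z \<partial>(\<mu> \<Otimes>\<^sub>M \<mu>))"
    by (intro nn_integral_eq_integral) (auto simp: lam_second_difference_nonneg)
  also have "\<dots> \<le> ennreal (b\<^sup>2 * m)" using le by (rule ennreal_leI)
  finally show ?thesis unfolding m_def .
qed

text \<open>Where the support function is twice differentiable this is the radius of curvature.\<close>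

definition lower_curvature_radius :: "'a::finite pmf \<Rightarrow> 'a score \<times> 'a score \<Rightarrow> ennreal" where
  "lower_curvature_radius p z
    = liminf (\<lambda>n. ennreal (lam_second_difference p (inverse (real (Suc n))) z * (real (Suc n))\<^sup>2))"

text \<open>A finite lower limit C yields arbitrarily small b with second difference below (C + 1)
  b^2. This is o(b) along a subsequence, which is enough to exclude a kink.\<close>

lemma unique_x_maximiser_SET:
  assumes "lower_curvature_radius p (S, T) \<noteq> \<infinity>"
  shows "\<exists>!z. is_x_maximiser (SET p S T) z"
proof -
  interpret planar_sublinear "\<lambda>a b. lam p (a *\<^sub>R S + b *\<^sub>R T)" by (rule planar_sublinear_lam)
  let ?u = "\<lambda>n. lam_second_difference p (inverse (real (Suc n))) (S, T) * (real (Suc n))\<^sup>2"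
  obtain C where C: "C \<ge> 0" "lower_curvature_radius p (S, T) = ennreal C"
    using assms by (cases "lower_curvature_radius p (S, T)") auto
  have freq: "\<exists>n\<ge>N. ?u n < C + 1" for N
  proof (rule ccontr)
    assume "\<not> ?thesis"
    then have "eventually (\<lambda>n. ennreal (C + 1) \<le> ennreal (?u n)) sequentially"
      unfolding eventually_sequentially by (intro exI[of _ N]) (auto simp: not_less intro!: ennreal_leI)
    then have "ennreal (C + 1) \<le> ennreal C"
      unfolding C(2)[symmetric] lower_curvature_radius_def by (rule Liminf_bounded)
    with C show False by (simp add: ennreal_le_iff)
  qed
  have "\<exists>!z. is_x_maximiser supported_set z"
  proof (rule unique_x_maximiser)
    fix \<epsilon> :: real assume \<epsilon>: "\<epsilon> > 0"
    obtain N where N: "inverse (real (Suc N)) < \<epsilon> / (C + 1)"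
      using reals_Archimedean[of "\<epsilon> / (C + 1)"] \<epsilon> C by auto
    obtain n where n: "n \<ge> N" "?u n < C + 1" using freq by blast
    define b where "b = inverse (real (Suc n))"
    have b: "b > 0" unfolding b_def by simp
    have bN: "b \<le> inverse (real (Suc N))" unfolding b_def using n by (intro le_imp_inverse_le) auto
    have "?u n = second_difference b / b\<^sup>2"
      unfolding second_difference_lam b_def by (simp add: divide_inverse power_inverse)
    then have "second_difference b < (C + 1) * b\<^sup>2"
      using n b by (simp add: divide_less_eq)
    also have "(C + 1) * b\<^sup>2 = ((C + 1) * b) * b" by (simp add: power2_eq_square)
    also have "\<dots> \<le> \<epsilon> * b"
    proof (rule mult_right_mono)
      have "b < \<epsilon> / (C + 1)" using bN N by linarith
      then show "(C + 1) * b \<le> \<epsilon>" using C by (simp add: less_divide_eq mult.commute)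
    qed (use b in simp)
    finally show "\<exists>b>0. second_difference b < \<epsilon> * b" using b by blast
  qed
  then show ?thesis unfolding SET_eq_supported_set .
qed

text \<open>The bound b^2/k, valid for all small b > 0, is sampled at b = 1/(n+1) and survives in
  the lower limit.\<close>

lemma lower_curvature_radius_ge:
  assumes "is_x_maximiser (SET p S T) z" "has_curvature (SET p S T) z \<kappa>" "\<kappa> < ereal k" and k: "k > 0"
  shows "ennreal (1 / k) \<le> lower_curvature_radius p (S, T)"
proof -
  interpret planar_sublinear "\<lambda>a b. lam p (a *\<^sub>R S + b *\<^sub>R T)" by (rule planar_sublinear_lam)
  have ev: "eventually (\<lambda>b. b\<^sup>2 / k \<le> second_difference b) (at_right 0)"
    using assms(1-3) unfolding SET_eq_supported_set by (rule curvature_second_difference)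
  have lim: "filterlim (\<lambda>n. inverse (real (Suc n))) (at_right 0) sequentially"
    by (intro filterlim_at_withinI) (auto simp: LIMSEQ_inverse_real_of_nat simp del: of_nat_Suc intro!: always_eventually)
  have "eventually (\<lambda>n. ennreal (1 / k)
      \<le> ennreal (lam_second_difference p (inverse (real (Suc n))) (S, T) * (real (Suc n))\<^sup>2)) sequentially"
    using eventually_compose_filterlim[OF ev lim]
  proof eventually_elim
    case (elim n)
    have "1 / k = (inverse (real (Suc n)))\<^sup>2 / k * (real (Suc n))\<^sup>2"
      by (simp add: power_mult_distrib[symmetric] del: of_nat_Suc)
    also have "\<dots> \<le> second_difference (inverse (real (Suc n))) * (real (Suc n))\<^sup>2"
      using elim by (rule mult_right_mono) simp
    finally show ?case unfolding second_difference_lam by (rule ennreal_leI)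
  qed
  then show ?thesis unfolding lower_curvature_radius_def by (rule Liminf_bounded)
qed

section \<open>Mean lower radius of curvature and the probability bound\<close>

lemma lower_curvature_radius_measurable:
  assumes [measurable_cong]: "sets \<mu> = sets borel"
  shows "lower_curvature_radius p \<in> borel_measurable (\<mu> \<Otimes>\<^sub>M \<mu>)"
  unfolding lower_curvature_radius_def lam_second_difference_def by measurable

text \<open>The factor b^2 in the mean second difference cancels the normalisation, so the quotients
  have uniformly bounded means and Fatou's lemma passes to the lower limit.\<close>

lemma nn_integral_lower_curvature_radius_le:
  fixes \<mu> :: "'a::finite score measure"
  assumes \<mu>: "invariant_measure sym_scores \<mu>" and unit: "AE R in \<mu>. norm R = 1"
  shows "(\<integral>\<^sup>+z. lower_curvature_radius p z \<partial>(\<mu> \<Otimes>\<^sub>M \<mu>)) \<le> ennreal (sqrt 6 / 2)"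
proof -
  have s [measurable_cong]: "sets \<mu> = sets borel" using \<mu> unfolding invariant_measure_def by auto
  let ?u = "\<lambda>n z. lam_second_difference p (inverse (real (Suc n))) z * (real (Suc n))\<^sup>2"
  have m [measurable]: "lam_second_difference p b \<in> borel_measurable (\<mu> \<Otimes>\<^sub>M \<mu>)" for b
    unfolding lam_second_difference_def by measurable
  have le: "(\<integral>\<^sup>+z. ennreal (?u n z) \<partial>(\<mu> \<Otimes>\<^sub>M \<mu>)) \<le> ennreal (sqrt 6 / 2)" for n
  proof -
    let ?b = "inverse (real (Suc n))"
    have "(\<integral>\<^sup>+z. ennreal (?u n z) \<partial>(\<mu> \<Otimes>\<^sub>M \<mu>))
        = (\<integral>\<^sup>+z. ennreal (lam_second_difference p ?b z) \<partial>(\<mu> \<Otimes>\<^sub>M \<mu>)) * ennreal ((real (Suc n))\<^sup>2)"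
      by (subst nn_integral_multc[symmetric]) (auto simp: ennreal_mult lam_second_difference_nonneg)
    also have "\<dots> \<le> ennreal (?b\<^sup>2 * (\<integral>R. lam p R \<partial>\<mu>)) * ennreal ((real (Suc n))\<^sup>2)"
      by (intro mult_right_mono integral_lam_second_difference_le \<mu> unit) auto
    also have "\<dots> = ennreal (\<integral>R. lam p R \<partial>\<mu>)"
      using integral_lam_bounds(1)[OF \<mu> unit, of p]
      by (simp add: ennreal_mult[symmetric] power_mult_distrib[symmetric] mult.assoc[symmetric] del: of_nat_Suc)
    also have "\<dots> \<le> ennreal (sqrt 6 / 2)" by (intro ennreal_leI integral_lam_bounds(2)[OF \<mu> unit])
    finally show ?thesis .
  qed
  have "(\<integral>\<^sup>+z. lower_curvature_radius p z \<partial>(\<mu> \<Otimes>\<^sub>M \<mu>))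
      \<le> liminf (\<lambda>n. \<integral>\<^sup>+z. ennreal (?u n z) \<partial>(\<mu> \<Otimes>\<^sub>M \<mu>))"
    unfolding lower_curvature_radius_def by (rule nn_integral_liminf) measurable
  also have "\<dots> \<le> liminf (\<lambda>n. ennreal (sqrt 6 / 2))"
    by (intro Liminf_mono always_eventually allI le)
  also have "\<dots> = ennreal (sqrt 6 / 2)" by (simp add: Liminf_const)
  finally show ?thesis .
qed

text \<open>It suffices that \<open>sqrt 6 * pi \<le> 8\<close>, which follows from
  \<open>sqrt 6 \<le> 5/2\<close> and \<open>pi \<le> 16/5\<close>. The latter is Machin's formula
  with arctan(1/5) at most 1/5 and the term arctan(1/239) dropped.\<close>

lemma sqrt6_half_le: "sqrt 6 / 2 \<le> 4 / pi"
proof -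
  have "sqrt 6 * pi \<le> (5 / 2) * (16 / 5)"
  proof (rule mult_mono)
    show "sqrt 6 \<le> 5 / 2" by (rule real_le_lsqrt) (simp_all add: power2_eq_square)
    have "(1 / 5 :: real) - arctan (1 / 5) \<ge> 0 - arctan 0"
    proof (rule DERIV_nonneg_imp_nondecreasing[of 0 "1 / 5" "\<lambda>x. x - arctan x"])
      fix x :: real
      have "((\<lambda>x. x - arctan x) has_real_derivative 1 - inverse (1 + x\<^sup>2)) (at x)"
        by (auto intro!: derivative_eq_intros)
      moreover have "inverse (1 + x\<^sup>2) \<le> 1" by (intro inverse_le_1_iff[THEN iffD2]) auto
      ultimately show "\<exists>y. ((\<lambda>x. x - arctan x) has_real_derivative y) (at x) \<and> 0 \<le> y"
        by (intro exI[of _ "1 - inverse (1 + x\<^sup>2)"]) simp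
    qed simp
    then have "arctan (1 / 5) \<le> 1 / 5" by simp
    moreover have "0 \<le> arctan (1 / 239)" by simp
    ultimately show "pi \<le> 16 / 5" using machin by linarith
  qed auto
  then show ?thesis by (simp add: field_simps)
qed

theorem theorem2:
  fixes p :: "'a::finite pmf" and \<mu> :: "'a score measure"
  assumes "uniform_on_sphere sym_scores \<mu>"
  shows "(AE ST in \<mu> \<Otimes>\<^sub>M \<mu>. \<exists>!z. is_x_maximiser (SET p (fst ST) (snd ST)) z)
    \<and> (\<forall>k::real. k > 0 \<longrightarrow>
        outer_measure_of (\<mu> \<Otimes>\<^sub>M \<mu>)
          {ST. \<exists>z. is_x_maximiser (SET p (fst ST) (snd ST)) z
                 \<and> (\<forall>w. is_x_maximiser (SET p (fst ST) (snd ST)) w \<longrightarrow> w = z)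
                 \<and> (\<exists>\<kappa>. has_curvature (SET p (fst ST) (snd ST)) z \<kappa> \<and> \<kappa> < ereal k)}
        \<le> ennreal (4 * k / pi))"
proof (intro conjI allI impI)
  note \<mu> = uniform_on_sphereD[OF assms subspace_sym_scores]
  have s: "sets \<mu> = sets borel" using \<mu>(1) unfolding invariant_measure_def by auto
  have space: "space (\<mu> \<Otimes>\<^sub>M \<mu>) = UNIV"
    using sets_eq_imp_space_eq[OF s] by (simp add: space_pair_measure)
  have meas [measurable]: "lower_curvature_radius p \<in> borel_measurable (\<mu> \<Otimes>\<^sub>M \<mu>)"
    using s by (rule lower_curvature_radius_measurable)
  note int = nn_integral_lower_curvature_radius_le[OF \<mu>, of p]
  have "AE ST in \<mu> \<Otimes>\<^sub>M \<mu>. lower_curvature_radius p ST \<noteq> \<infinity>"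
    using int by (intro nn_integral_PInf_AE) (auto simp: top_unique)
  then show "AE ST in \<mu> \<Otimes>\<^sub>M \<mu>. \<exists>!z. is_x_maximiser (SET p (fst ST) (snd ST)) z"
    by eventually_elim (simp add: unique_x_maximiser_SET)
  fix k :: real assume k: "k > 0"
  let ?E = "{ST. \<exists>z. is_x_maximiser (SET p (fst ST) (snd ST)) z
                 \<and> (\<forall>w. is_x_maximiser (SET p (fst ST) (snd ST)) w \<longrightarrow> w = z)
                 \<and> (\<exists>\<kappa>. has_curvature (SET p (fst ST) (snd ST)) z \<kappa> \<and> \<kappa> < ereal k)}"
  \<comment> \<open>A measurable set containing the event \<open>?E\<close>. Passing to it through
    outer measure avoids proving that \<open>?E\<close> is measurable, and Markov's inequality
    applies to it.\<close>
  let ?A = "{ST \<in> space (\<mu> \<Otimes>\<^sub>M \<mu>). 1 \<le> ennreal k * lower_curvature_radius p ST}"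
  have A: "?A \<in> sets (\<mu> \<Otimes>\<^sub>M \<mu>)" by measurable
  have "?E \<subseteq> ?A"
  proof
    fix ST assume "ST \<in> ?E"
    then have "ennreal (1 / k) \<le> lower_curvature_radius p (fst ST, snd ST)"
      using k lower_curvature_radius_ge by blast
    then have "ennreal k * ennreal (1 / k) \<le> ennreal k * lower_curvature_radius p ST"
      by (intro mult_left_mono) auto
    then show "ST \<in> ?A" using k by (simp add: space ennreal_mult'[symmetric])
  qed
  then have "outer_measure_of (\<mu> \<Otimes>\<^sub>M \<mu>) ?E \<le> outer_measure_of (\<mu> \<Otimes>\<^sub>M \<mu>) ?A"
    by (rule outer_measure_of_mono)
  also have "\<dots> = emeasure (\<mu> \<Otimes>\<^sub>M \<mu>) ?A" using A by (rule outer_measure_of_eq)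
  also have "\<dots> \<le> ennreal k * (\<integral>\<^sup>+ST. lower_curvature_radius p ST * indicator (space (\<mu> \<Otimes>\<^sub>M \<mu>)) ST \<partial>(\<mu> \<Otimes>\<^sub>M \<mu>))"
    by (rule nn_integral_Markov_inequality) (auto intro: meas)
  also have "\<dots> = ennreal k * (\<integral>\<^sup>+ST. lower_curvature_radius p ST \<partial>(\<mu> \<Otimes>\<^sub>M \<mu>))"
    by (simp add: space)
  also have "\<dots> \<le> ennreal k * ennreal (4 / pi)"
    by (intro mult_left_mono order_trans[OF int] ennreal_leI sqrt6_half_le) auto
  also have "\<dots> = ennreal (4 * k / pi)" using k by (simp add: ennreal_mult'[symmetric] mult_ac)
  finally show "outer_measure_of (\<mu> \<Otimes>\<^sub>M \<mu>) ?E \<le> ennreal (4 * k / pi)" .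
qed

end
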